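(* Let $A_1,A_2\in\mathbb{R}^{2\times2}$ be such that $P_0=\mathbb{R}^2$, $P_1=(A_1+iI)\mathbb{R}^2$, $P_2=(A_2+iI)\mathbb{R}^2$ are maximal totally real subspaces of $\mathbb{C}^2$. Suppose that the union of any two of $P_0,P_1,P_2$ is locally polynomially convex at the origin, that $\det[A_1,A_2]>0$, that $-1<\det A_1<0$, and that $\det A_2>0$. Then $P_0\cup P_1\cup P_2$ is locally polynomially convex at the origin.
   Context: A maximal totally real subspace of $\mathbb{C}^2$ is a real-linear subspace $P$ of real dimension $2$ with $P\cap iP=\{0\}$. $[A_1,A_2]=A_1A_2-A_2A_1$. A compact set $K\subset\mathbb{C}^2$ is polynomially convex if $K=\{z\in\mathbb{C}^2:|p(z)|\le\sup_K|p|\ \ \forall p\in\mathbb{C}[z_1,z_2]\}$. A closed set $S$ is locally polynomially convex at $a\in S$ if $S\cap\overline{B(a,r)}$ is polynomially convex for some $r>0$. *)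

theory Defs
  imports
    "HOL-Analysis.Analysis"
    "HOL-Computational_Algebra.Polynomial"
begin

text \<open>\<^typ>\<open>complex poly poly\<close> is the ring of polynomials in \<open>z\<^sub>2\<close> over the ring of
  polynomials in \<open>z\<^sub>1\<close>: the inner \<^const>\<open>poly\<close> substitutes \<open>z $ 2\<close> for the outer variable, the
  outer one substitutes \<open>z $ 1\<close> in the coefficients (see \<open>eval2_monom\<close>).\<close>

definition eval2 :: "complex poly poly \<Rightarrow> complex ^ 2 \<Rightarrow> complex" where
  "eval2 p z = poly (poly p [:z $ 2:]) (z $ 1)"

lemma eval2_monom: "eval2 (monom (monom c j) k) z = c * (z $ 1) ^ j * (z $ 2) ^ k"
  by (simp add: eval2_def poly_monom)

text \<open>The empty set is polynomially convex whatever the real number \<^term>\<open>Sup {} :: real\<close> is,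
  because a constant polynomial exceeds it.\<close>

definition polynomially_convex :: "(complex ^ 2) set \<Rightarrow> bool" where
  "polynomially_convex K \<longleftrightarrow>
     compact K \<and> K = {z. \<forall>p. norm (eval2 p z) \<le> (SUP w\<in>K. norm (eval2 p w))}"

definition locally_polynomially_convex_at :: "(complex ^ 2) set \<Rightarrow> complex ^ 2 \<Rightarrow> bool" where
  "locally_polynomially_convex_at S a \<longleftrightarrow>
     closed S \<and> a \<in> S \<and> (\<exists>r>0. polynomially_convex (S \<inter> cball a r))"

text \<open>\<^const>\<open>subspace\<close> and \<^const>\<open>dim\<close> are the real-linear notions, while \<open>*s\<close> multiplies by a
  complex scalar.\<close>

definition maximal_totally_real :: "(complex ^ 2) set \<Rightarrow> bool" where
  "maximal_totally_real P \<longleftrightarrow>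
     subspace P \<and> dim P = 2 \<and> P \<inter> (\<lambda>z. \<i> *s z) ` P = {0}"

definition of_real_vec :: "real ^ 2 \<Rightarrow> complex ^ 2" where
  "of_real_vec x = (\<chi> j. complex_of_real (x $ j))"

definition of_real_mat :: "real ^ 2 ^ 2 \<Rightarrow> complex ^ 2 ^ 2" where
  "of_real_mat A = (\<chi> j k. complex_of_real (A $ j $ k))"

definition real_plane :: "(complex ^ 2) set" where
  "real_plane = range of_real_vec"

text \<open>\<^term>\<open>mat \<i>\<close> is the scalar matrix \<open>\<i> I\<close>.\<close>

definition shifted_plane :: "real ^ 2 ^ 2 \<Rightarrow> (complex ^ 2) set" where
  "shifted_plane A = (\<lambda>x. (of_real_mat A + mat \<i>) *v x) ` real_plane"

definition commutator :: "real ^ 2 ^ 2 \<Rightarrow> real ^ 2 ^ 2 \<Rightarrow> real ^ 2 ^ 2" where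
  "commutator A B = A ** B - B ** A"

end

theory Submission
  imports Defs "HOL-Complex_Analysis.Winding_Numbers"
begin

text \<open>The condition \<open>det (commutator A1 A2) > 0\<close> says that \<open>A1\<close> and \<open>A2\<close> are simultaneously
  symmetric for some Euclidean structure on the real plane: with \<open>J\<close> the rotation by a right
  angle, \<open>J * commutator A1 A2\<close> or its negative is a positive definite symmetric matrix \<open>G\<close> for
  which both are self-adjoint (\<open>commutator_symmetrizing_form\<close>). Consider the complex quadratic form
  \<open>p z = z\<^sup>T G z\<close>. It maps the real plane to the nonnegative half-line. For a self-adjoint \<open>A\<close> with
  \<open>det A > -1\<close>, the Cayley--Hamilton theorem shows that \<open>p\<close> maps \<open>shifted_plane A\<close> into the complement
  of an open sector around the positive half-line, and that \<open>p\<close> vanishes on this plane only at \<open>0\<close>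
  (\<open>quad_form_shifted_plane\<close>). Hence \<open>p\<close> separates the first plane from the union of the other two,
  which is polynomially convex near \<open>0\<close> by hypothesis, and Kallin's lemma gives the theorem.

  The case of Kallin's lemma that occurs here is \<open>polynomially_convex_Un_ray_sector\<close>. Its proof needs
  polynomials in one variable that are close to \<open>1\<close> on a segment \<open>[0, R]\<close> and close to \<open>0\<close> outside
  a sector around it, although the two sets touch at \<open>0\<close>. It is enough to have this after
  multiplication by \<open>w\<^sup>2\<close> (\<open>step_polynomial\<close>). The step function is written as the winding number of a
  triangle with a vertex at \<open>0\<close>, the contour integral is replaced by Riemann sums, and the
  resolvents that appear there are approximated by polynomials by pushing their poles along rays
  to infinity (\<open>poly_approximable_resolvent\<close>).\<close>

section \<open>Uniform approximation by polynomials in one variable\<close>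

text \<open>The weight \<open>u\<close> fixes a factor of the approximating polynomials. With \<open>u w = w\<^sup>2\<close> the
  class consists of uniform limits of polynomials that vanish to order two at \<open>0\<close>, and it is
  essential to have this factor exactly, not just approximately.\<close>

definition poly_approximable :: "(complex \<Rightarrow> complex) \<Rightarrow> complex set \<Rightarrow> (complex \<Rightarrow> complex) \<Rightarrow> bool" where
  "poly_approximable u W f \<longleftrightarrow>
     (\<forall>e>0. \<exists>q. \<forall>w\<in>W. norm (f w - u w * poly q w) < e)"

lemma poly_approximableD:
  assumes "poly_approximable u W f" "e > 0"
  obtains q where "\<And>w. w \<in> W \<Longrightarrow> norm (f w - u w * poly q w) < e"
  using assms unfolding poly_approximable_def by blast

lemma poly_approximable_poly: "poly_approximable u W (\<lambda>w. u w * poly q w)"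
  unfolding poly_approximable_def by (intro allI impI exI[of _ q]) auto

lemma poly_approximable_cong:
  assumes "poly_approximable u W f" "\<And>w. w \<in> W \<Longrightarrow> f w = g w"
  shows "poly_approximable u W g"
  using assms unfolding poly_approximable_def by simp

lemma poly_approximable_closed:
  assumes "\<And>e. e > 0 \<Longrightarrow> \<exists>g. poly_approximable u W g \<and> (\<forall>w\<in>W. norm (f w - g w) < e)"
  shows "poly_approximable u W f"
  unfolding poly_approximable_def
proof (intro allI impI)
  fix e :: real assume "e > 0"
  then obtain g where g: "poly_approximable u W g" "\<And>w. w \<in> W \<Longrightarrow> norm (f w - g w) < e/2"
    using assms[of "e/2"] by auto
  obtain q where q: "\<And>w. w \<in> W \<Longrightarrow> norm (g w - u w * poly q w) < e/2"
    using poly_approximableD[OF g(1), of "e/2"] \<open>e > 0\<close> by auto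
  have "norm (f w - u w * poly q w) < e" if "w \<in> W" for w
    using norm_triangle_ineq[of "f w - g w" "g w - u w * poly q w"] g(2)[OF that] q[OF that] by simp
  then show "\<exists>q. \<forall>w\<in>W. norm (f w - u w * poly q w) < e" by blast
qed

lemma poly_approximable_add:
  assumes "poly_approximable u W f" "poly_approximable u W g"
  shows "poly_approximable u W (\<lambda>w. f w + g w)"
  unfolding poly_approximable_def
proof (intro allI impI)
  fix e :: real assume "e > 0"
  then obtain p q where pq: "\<And>w. w \<in> W \<Longrightarrow> norm (f w - u w * poly p w) < e/2"
      "\<And>w. w \<in> W \<Longrightarrow> norm (g w - u w * poly q w) < e/2"
    using poly_approximableD[OF assms(1), of "e/2"] poly_approximableD[OF assms(2), of "e/2"]
    by (metis half_gt_zero)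
  have "norm (f w + g w - u w * poly (p + q) w) < e" if "w \<in> W" for w
    using norm_triangle_ineq[of "f w - u w * poly p w" "g w - u w * poly q w"] pq[OF that]
    by (simp add: algebra_simps)
  then show "\<exists>q. \<forall>w\<in>W. norm (f w + g w - u w * poly q w) < e" by blast
qed

lemma poly_approximable_mult_weight:
  assumes f: "poly_approximable u W f" and g: "poly_approximable v W g"
    and B: "\<And>w. w \<in> W \<Longrightarrow> norm (f w) \<le> B"
    and v: "\<And>w. w \<in> W \<Longrightarrow> norm (v w) \<le> C" and W: "bounded W"
  shows "poly_approximable (\<lambda>w. u w * v w) W (\<lambda>w. f w * g w)"
  unfolding poly_approximable_def
proof (intro allI impI)
  fix e :: real assume e: "e > 0"
  define B' where "B' = \<bar>B\<bar> + 1"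
  have B': "B' > 0" "\<And>w. w \<in> W \<Longrightarrow> norm (f w) \<le> B'"
    using B by (force simp: B'_def)+
  obtain q where q: "\<And>w. w \<in> W \<Longrightarrow> norm (g w - v w * poly q w) < e / (2*B')"
    using poly_approximableD[OF g, of "e/(2*B')"] e B' by (metis divide_pos_pos mult_pos_pos zero_less_numeral)
  have "bounded (poly q ` closure W)"
    using W by (intro compact_imp_bounded compact_continuous_image continuous_intros) auto
  then obtain D0 where D0: "\<And>w. w \<in> W \<Longrightarrow> norm (poly q w) \<le> D0"
    using closure_subset unfolding bounded_iff by blast
  define D where "D = (\<bar>C\<bar>+1) * (\<bar>D0\<bar> + 1)"
  have D: "D > 0" "\<And>w. w \<in> W \<Longrightarrow> norm (v w * poly q w) \<le> D"
  proof -
    show "D > 0" by (simp add: D_def add_nonneg_pos)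
    show "norm (v w * poly q w) \<le> D" if "w \<in> W" for w
      unfolding D_def norm_mult using v[OF that] D0[OF that] by (intro mult_mono) auto
  qed
  obtain p where p: "\<And>w. w \<in> W \<Longrightarrow> norm (f w - u w * poly p w) < e / (2*D)"
    using poly_approximableD[OF f, of "e/(2*D)"] e D by (metis divide_pos_pos mult_pos_pos zero_less_numeral)
  have "norm (f w * g w - u w * v w * poly (p * q) w) < e" if w: "w \<in> W" for w
  proof -
    have "f w * g w - u w * v w * poly (p * q) w =
        f w * (g w - v w * poly q w) + (f w - u w * poly p w) * (v w * poly q w)"
      by (simp add: algebra_simps)
    moreover have "norm (f w * (g w - v w * poly q w)) \<le> B' * (e / (2*B'))"
      unfolding norm_mult using B'(2)[OF w] q[OF w] B'(1) by (intro mult_mono) auto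
    moreover have "norm ((f w - u w * poly p w) * (v w * poly q w)) < e / (2*D) * D"
    proof -
      have "norm ((f w - u w * poly p w) * (v w * poly q w)) \<le> norm (f w - u w * poly p w) * D"
        unfolding norm_mult[of "f w - u w * poly p w"] using D(2)[OF w] by (intro mult_left_mono) auto
      also have "\<dots> < e / (2*D) * D" using p[OF w] D(1) by (intro mult_strict_right_mono)
      finally show ?thesis .
    qed
    moreover have "B' * (e / (2*B')) = e/2" "e / (2*D) * D = e/2" using B'(1) D(1) by auto
    ultimately show ?thesis
      using norm_triangle_ineq[of "f w * (g w - v w * poly q w)" "(f w - u w * poly p w) * (v w * poly q w)"]
      by (simp only:)
  qed
  then show "\<exists>q. \<forall>w\<in>W. norm (f w * g w - u w * v w * poly q w) < e" by blast
qed

lemma poly_approximable_bounded: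
  assumes f: "poly_approximable (\<lambda>_. 1) W f" and W: "bounded W"
  obtains B where "\<And>w. w \<in> W \<Longrightarrow> norm (f w) \<le> B"
proof -
  obtain q where q: "\<And>w. w \<in> W \<Longrightarrow> norm (f w - 1 * poly q w) < 1"
    using poly_approximableD[OF f, of 1] by (metis zero_less_one)
  have "bounded (poly q ` closure W)"
    using W by (intro compact_imp_bounded compact_continuous_image continuous_intros) auto
  then obtain D where D: "\<And>w. w \<in> W \<Longrightarrow> norm (poly q w) \<le> D"
    using closure_subset unfolding bounded_iff by blast
  have "norm (f w) \<le> 1 + D" if "w \<in> W" for w
    using norm_triangle_ineq[of "f w - poly q w" "poly q w"] q[OF that] D[OF that] by simp
  then show thesis by (rule that)
qed

lemma poly_approximable_mult:
  assumes f: "poly_approximable (\<lambda>_. 1) W f" and g: "poly_approximable (\<lambda>_. 1) W g" and W: "bounded W"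
  shows "poly_approximable (\<lambda>_. 1) W (\<lambda>w. f w * g w)"
proof -
  obtain B where "\<And>w. w \<in> W \<Longrightarrow> norm (f w) \<le> B" using poly_approximable_bounded[OF f W] by blast
  from poly_approximable_mult_weight[OF f g this, of 1] W show ?thesis by simp
qed

lemma poly_approximable_const: "poly_approximable (\<lambda>_. 1) W (\<lambda>_. c)"
  using poly_approximable_poly[of "\<lambda>_. 1" W "[:c:]"] by simp

lemma poly_approximable_cmult:
  assumes "poly_approximable u W f"
  shows "poly_approximable u W (\<lambda>w. c * f w)"
  unfolding poly_approximable_def
proof (intro allI impI)
  fix e :: real assume e: "e > 0"
  obtain q where q: "\<And>w. w \<in> W \<Longrightarrow> norm (f w - u w * poly q w) < e / (norm c + 1)"
    using poly_approximableD[OF assms, of "e / (norm c + 1)"] e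
    by (metis add_nonneg_pos divide_pos_pos norm_ge_zero zero_less_one)
  have "norm (c * f w - u w * poly (smult c q) w) < e" if "w \<in> W" for w
  proof -
    have "norm (c * f w - u w * poly (smult c q) w) = norm c * norm (f w - u w * poly q w)"
      by (simp add: norm_mult[symmetric] algebra_simps)
    also have "\<dots> \<le> norm c * (e / (norm c + 1))"
      using q[OF that] by (intro mult_left_mono) auto
    also have "\<dots> < e" using e by (simp add: divide_simps add_nonneg_pos)
    finally show ?thesis .
  qed
  then show "\<exists>q. \<forall>w\<in>W. norm (c * f w - u w * poly q w) < e" by blast
qed

lemma poly_approximable_sum:
  assumes "\<And>i. i \<in> I \<Longrightarrow> poly_approximable u W (f i)"
  shows "poly_approximable u W (\<lambda>w. \<Sum>i\<in>I. f i w)"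
  using assms
proof (induction I rule: infinite_finite_induct)
  case (insert i I)
  then show ?case by (simp add: poly_approximable_add)
qed (use poly_approximable_poly[of u W 0] in auto)

text \<open>Partial sums of the geometric series.\<close>

lemma poly_approximable_inverse_one_minus:
  assumes f: "poly_approximable (\<lambda>_. 1) W f" and W: "bounded W"
    and small: "\<And>w. w \<in> W \<Longrightarrow> norm (f w) \<le> 1/2"
  shows "poly_approximable (\<lambda>_. 1) W (\<lambda>w. 1 / (1 - f w))"
proof (rule poly_approximable_closed)
  fix e :: real assume e: "e > 0"
  obtain n where n: "(1/2::real)^n < e/2"
    using real_arch_pow_inv[of "e/2" "1/2"] e by auto
  have pow: "poly_approximable (\<lambda>_. 1) W (\<lambda>w. f w ^ k)" for k
    by (induction k) (auto intro: poly_approximable_const poly_approximable_mult f W)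
  have "norm (1 / (1 - f w) - (\<Sum>k<n. f w ^ k)) < e" if w: "w \<in> W" for w
  proof -
    have 1: "norm (1 - f w) \<ge> 1/2"
      using norm_triangle_ineq2[of 1 "f w"] small[OF w] by simp
    then have ne: "f w \<noteq> 1" by auto
    have "1 / (1 - f w) - (\<Sum>k<n. f w ^ k) = f w ^ n / (1 - f w)"
      using ne by (simp add: sum_gp_strict field_simps)
    also have "norm \<dots> = norm (f w) ^ n / norm (1 - f w)"
      by (simp add: norm_divide norm_power)
    also have "\<dots> \<le> (1/2)^n / (1/2)"
      using 1 small[OF w] by (intro frac_le power_mono) auto
    also have "\<dots> < e" using n by simp
    finally show ?thesis .
  qed
  then show "\<exists>g. poly_approximable (\<lambda>_. 1) W g \<and> (\<forall>w\<in>W. norm (1 / (1 - f w) - g w) < e)"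
    by (intro exI[of _ "\<lambda>w. \<Sum>k<n. f w ^ k"] conjI ballI poly_approximable_sum pow)
qed

text \<open>Pole pushing. The ray \<open>{t \<zeta> | t \<ge> 1}\<close> misses the star-shaped set \<open>W\<close>, with positive distance.
  Far out on this ray the resolvent is a geometric series in \<open>w\<close>; and a resolvent with pole
  \<open>t \<zeta>\<close> is a geometric series in the resolvent with a pole slightly further out. Finitely many
  steps of fixed length bring the pole to \<open>\<zeta>\<close>.\<close>

lemma poly_approximable_resolvent:
  assumes W: "compact W" and star: "\<And>w s. w \<in> W \<Longrightarrow> 0 \<le> s \<Longrightarrow> s \<le> 1 \<Longrightarrow> of_real s * w \<in> W"
    and z: "\<zeta> \<notin> W"
  shows "poly_approximable (\<lambda>_. 1) W (\<lambda>w. 1 / (w - \<zeta>))"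
proof (cases "W = {}")
  case True
  then show ?thesis by (simp add: poly_approximable_def)
next
  case False
  have bW: "bounded W" using W compact_imp_bounded by blast
  have "0 \<in> W" using False star[of _ 0] by auto
  then have z0: "\<zeta> \<noteq> 0" using z by auto
  obtain R where R: "R > 0" "\<And>w. w \<in> W \<Longrightarrow> norm w \<le> R" using bW by (auto simp: bounded_pos)
  obtain d where d: "d > 0" "\<And>w. w \<in> W \<Longrightarrow> d \<le> dist \<zeta> w"
    using separate_point_closed[OF compact_imp_closed[OF W] z] by blast
  have dt: "d \<le> norm (w - of_real t * \<zeta>)" if "w \<in> W" "t \<ge> 1" for w t
  proof -
    have "of_real (1/t) * w \<in> W" using that by (intro star) auto
    then have "d \<le> norm (of_real (1/t) * w - \<zeta>)" using d(2) by (metis dist_commute dist_norm)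
    also have "\<dots> \<le> t * norm (of_real (1/t) * w - \<zeta>)" using that
      by (simp add: mult_le_cancel_right1)
    also have "\<dots> = norm (of_real t * (of_real (1/t) * w - \<zeta>))" using that by (simp add: norm_mult)
    also have "of_real t * (of_real (1/t) * w - \<zeta>) = w - of_real t * \<zeta>"
      using that by (simp add: field_simps)
    finally show ?thesis .
  qed
  \<comment> \<open>\<open>T\<close> and \<open>h\<close> make the ratios of the two kinds of geometric series at most \<open>1/2\<close>.\<close>
  define T h where "T = 2 * R / norm \<zeta>" and "h = d / (2 * norm \<zeta>)"
  have h: "h > 0" using d z0 by (simp add: h_def)
  have ind: "poly_approximable (\<lambda>_. 1) W (\<lambda>w. 1 / (w - of_real t * \<zeta>))"
    if "t \<ge> 1" "t \<ge> T - real n * h" for n t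
    using that
  proof (induction n arbitrary: t)
    case 0
    define c where "c = of_real t * \<zeta>"
    have c: "norm c \<ge> 2 * R" "c \<noteq> 0" using 0 z0 by (auto simp: c_def norm_mult T_def field_simps)
    have "poly_approximable (\<lambda>_. 1) W (\<lambda>w. poly [:0, 1/c:] w)"
      using poly_approximable_poly[of "\<lambda>_. 1" W "[:0, 1/c:]"] by simp
    then have "poly_approximable (\<lambda>_. 1) W (\<lambda>w. 1 / (1 - w / c))"
    proof -
      assume "poly_approximable (\<lambda>_. 1) W (\<lambda>w. poly [:0, 1/c:] w)"
      then have *: "poly_approximable (\<lambda>_. 1) W (\<lambda>w. w / c)" by simp
      have "norm (w / c) \<le> 1/2" if "w \<in> W" for w
        using R(2)[OF that] c by (simp add: norm_divide field_simps)
      from poly_approximable_inverse_one_minus[OF * bW this] show ?thesis .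
    qed
    from poly_approximable_cmult[OF this, of "-1/c"]
    show ?case
    proof (rule poly_approximable_cong)
      fix w assume "w \<in> W"
      then have "w - c \<noteq> 0" using dt[of w t] 0 d(1) by (auto simp: c_def)
      then show "- 1 / c * (1 / (1 - w / c)) = 1 / (w - of_real t * \<zeta>)"
        using c(2) unfolding c_def[symmetric] by (simp add: divide_simps)
    qed
  next
    case (Suc n)
    have t: "t + h \<ge> 1" "t + h \<ge> T - real n * h" using Suc.prems h by (auto simp: algebra_simps)
    define f where "f w = 1 / (w - of_real (t + h) * \<zeta>)" for w
    have f: "poly_approximable (\<lambda>_. 1) W f" unfolding f_def by (rule Suc.IH[OF t])
    have fb: "norm (f w) \<le> 1 / d" if "w \<in> W" for w
      using dt[OF that t(1)] d(1) by (simp add: f_def norm_divide frac_le)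
    have g: "poly_approximable (\<lambda>_. 1) W (\<lambda>w. (- of_real h * \<zeta>) * f w)"
      by (rule poly_approximable_cmult[OF f])
    have "norm ((- of_real h * \<zeta>) * f w) \<le> 1/2" if "w \<in> W" for w
    proof -
      have "norm ((- of_real h * \<zeta>) * f w) \<le> (h * norm \<zeta>) * (1 / d)"
        unfolding norm_mult using fb[OF that] h by (intro mult_mono) auto
      also have "\<dots> = 1/2" using z0 d(1) by (simp add: h_def)
      finally show ?thesis .
    qed
    from poly_approximable_mult[OF f poly_approximable_inverse_one_minus[OF g bW this] bW]
    show ?case
    proof (rule poly_approximable_cong)
      fix w assume w: "w \<in> W"
      have "w - of_real t * \<zeta> \<noteq> 0" "w - of_real (t + h) * \<zeta> \<noteq> 0"
        using dt[OF w Suc.prems(1)] dt[OF w t(1)] d(1) by auto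
      moreover define x where "x = w - of_real (t + h) * \<zeta>"
      moreover have "w - of_real t * \<zeta> = x + of_real h * \<zeta>" by (simp add: x_def algebra_simps)
      ultimately show "f w * (1 / (1 - (- of_real h * \<zeta>) * f w)) = 1 / (w - of_real t * \<zeta>)"
        unfolding f_def x_def[symmetric] by (simp add: divide_simps)
    qed
  qed
  obtain n where "T - 1 \<le> real n * h"
    using h by (metis reals_Archimedean3 less_imp_le)
  then show ?thesis using ind[of 1 n] by simp
qed

lemma riemann_sum_error:
  fixes f :: "real \<Rightarrow> complex"
  assumes f: "continuous_on {0..1} f" and n: "n > 0" and e: "e \<ge> 0"
    and osc: "\<And>s t. s \<in> {0..1} \<Longrightarrow> t \<in> {0..1} \<Longrightarrow> \<bar>s - t\<bar> \<le> 1 / real n \<Longrightarrow> norm (f s - f t) \<le> e"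
  shows "norm (integral {0..1} f - (\<Sum>k<n. f (real (Suc k) / real n) / of_nat n)) \<le> e"
proof -
  have "norm (integral {0..real m / real n} f - (\<Sum>k<m. f (real (Suc k) / real n) / of_nat n)) \<le> e * (real m / real n)"
    if "m \<le> n" for m
    using that
  proof (induction m)
    case (Suc m)
    let ?a = "real m / real n" and ?b = "real (Suc m) / real n"
    have ab: "0 \<le> ?a" "?a \<le> ?b" "?b \<le> 1" "?b - ?a = 1 / real n"
      using Suc.prems n by (auto simp: field_simps)
    have int: "f integrable_on {0..?b}"
      by (rule integrable_continuous_real, rule continuous_on_subset[OF f]) (use ab in auto)
    have int2: "f integrable_on {?a..?b}"
      by (rule integrable_continuous_real, rule continuous_on_subset[OF f]) (use ab in auto)
    have split: "integral {0..?b} f = integral {0..?a} f + integral {?a..?b} f"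
      using Henstock_Kurzweil_Integration.integral_combine[OF ab(1,2) int] by simp
    have "((\<lambda>t. f t - f ?b) has_integral (integral {?a..?b} f - (?b - ?a) *\<^sub>R f ?b)) {?a..?b}"
      using ab has_integral_const_real[of "f ?b" ?a ?b]
      by (intro has_integral_diff integrable_integral int2) (auto)
    moreover have bd: "\<forall>t\<in>{?a..?b}. norm (f t - f ?b) \<le> e"
    proof (intro ballI osc)
      fix t assume t: "t \<in> {?a..?b}"
      then show "t \<in> {0..1}" "\<bar>t - ?b\<bar> \<le> 1 / real n"
        using ab order_trans[OF ab(1), of t] by (auto simp del: of_nat_Suc)
      show "?b \<in> {0..1}" using ab by simp
    qed
    ultimately have "norm (integral {?a..?b} f - (?b - ?a) *\<^sub>R f ?b) \<le> e * (?b - ?a)"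
      using has_integral_bound_real[OF e finite.emptyI, of "\<lambda>t. f t - f ?b" _ ?a ?b] ab(2)
      by (simp del: of_nat_Suc)
    then have "norm (integral {?a..?b} f - f ?b / of_nat n) \<le> e * (1 / real n)"
      unfolding ab(4) by (simp add: scaleR_conv_of_real)
    moreover have "norm (integral {0..?a} f - (\<Sum>k<m. f (real (Suc k) / real n) / of_nat n)) \<le> e * ?a"
      using Suc by simp
    ultimately show ?case
      unfolding split using norm_triangle_ineq[of "integral {0..?a} f - (\<Sum>k<m. f (real (Suc k) / real n) / of_nat n)" "integral {?a..?b} f - f ?b / of_nat n"]
      by (simp add: algebra_simps add_divide_distrib)
  qed simp
  from this[of n] n show ?thesis by simp
qed

text \<open>Riemann sums converge uniformly in the parameter \<open>w\<close>. They are taken at right end points, so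
  that nothing has to be known about \<open>F 0\<close>: this is where the path of integration below meets
  the set \<open>W\<close>.\<close>

lemma poly_approximable_integral:
  fixes F :: "real \<Rightarrow> complex \<Rightarrow> complex"
  assumes W: "compact W"
    and cont: "continuous_on ({0..1} \<times> W) (\<lambda>(t, w). F t w)"
    and F: "\<And>t. 0 < t \<Longrightarrow> t \<le> 1 \<Longrightarrow> poly_approximable u W (F t)"
  shows "poly_approximable u W (\<lambda>w. integral {0..1} (\<lambda>t. F t w))"
proof (rule poly_approximable_closed)
  fix e :: real assume e: "e > 0"
  have "uniformly_continuous_on ({0..1} \<times> W) (\<lambda>(t, w). F t w)"
    using W by (intro compact_uniformly_continuous[OF cont] compact_Times) auto
  then obtain d where d: "d > 0" and du: "\<And>x x'. x \<in> {0..1} \<times> W \<Longrightarrow> x' \<in> {0..1} \<times> W \<Longrightarrow> dist x' x < d \<Longrightarrow>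
      dist ((\<lambda>(t, w). F t w) x') ((\<lambda>(t, w). F t w) x) < e/2"
    using e unfolding uniformly_continuous_on_def by (metis half_gt_zero)
  obtain n :: nat where n: "n > 0" "1 / real n < d"
    using nat_approx_posE[OF d] by (metis zero_less_Suc)
  let ?S = "\<lambda>w. \<Sum>k<n. (1 / of_nat n) * F (real (Suc k) / real n) w"
  have "norm (integral {0..1} (\<lambda>t. F t w) - ?S w) \<le> e/2" if w: "w \<in> W" for w
  proof -
    have "continuous_on {0..1} (\<lambda>t. (\<lambda>(t, w). F t w) (t, w))"
      by (rule continuous_on_compose2[OF cont]) (use w in \<open>auto intro!: continuous_intros\<close>)
    then have "continuous_on {0..1} (\<lambda>t. F t w)" by simp
    moreover have "norm (F s w - F t w) \<le> e/2" if "s \<in> {0..1}" "t \<in> {0..1}" "\<bar>s - t\<bar> \<le> 1 / real n" for s t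
      using du[of "(t, w)" "(s, w)"] that w n by (simp add: dist_norm dist_Pair_Pair)
    ultimately show ?thesis using riemann_sum_error[of "\<lambda>t. F t w" n "e/2"] n e by simp
  qed
  moreover have "poly_approximable u W ?S"
    using n by (intro poly_approximable_sum poly_approximable_cmult F) (auto simp: field_simps)
  ultimately show "\<exists>g. poly_approximable u W g \<and> (\<forall>w\<in>W. norm (integral {0..1} (\<lambda>t. F t w) - g w) < e)"
    using e by (intro exI[of _ ?S]) (fastforce intro: le_less_trans)
qed

section \<open>Cauchy integrals over paths in a sector\<close>

text \<open>The set on which a step function has to be approximated: a segment of the positive real axis
  together with the part of a disc outside an open sector around this axis. It is star-shaped,
  and its two pieces touch at \<open>0\<close> only.\<close>

definition step_domain :: "real \<Rightarrow> real \<Rightarrow> complex set" where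
  "step_domain c R = {w. norm w \<le> R \<and> (Re w \<le> c * \<bar>Im w\<bar> \<or> Im w = 0 \<and> 0 \<le> Re w)}"

lemma compact_step_domain: "compact (step_domain c R)"
proof -
  have "step_domain c R = cball 0 R \<inter> ({w. Re w \<le> c * \<bar>Im w\<bar>} \<union> ({w. Im w = 0} \<inter> {w. 0 \<le> Re w}))"
    by (auto simp: step_domain_def)
  moreover have "closed ({w. Re w \<le> c * \<bar>Im w\<bar>} \<union> ({w. Im w = 0} \<inter> {w. 0 \<le> Re w}))"
    by (intro closed_Un closed_Int closed_Collect_le closed_Collect_eq continuous_intros)
  ultimately show ?thesis by (simp add: compact_Int_closed)
qed

lemma step_domain_star:
  assumes "w \<in> step_domain c R" "0 \<le> s" "s \<le> 1"
  shows "of_real s * w \<in> step_domain c R"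
proof -
  have "s * norm w \<le> norm w" using assms(2,3) by (simp add: mult_left_le_one_le)
  moreover have "s * Re w \<le> c * \<bar>s * Im w\<bar>" if "Re w \<le> c * \<bar>Im w\<bar>"
    using mult_left_mono[OF that assms(2)] assms(2) by (simp add: abs_mult algebra_simps)
  ultimately show ?thesis
    using assms by (auto simp: step_domain_def norm_mult)
qed

text \<open>The rays of slope \<open>\<plusminus>1 / (2 c)\<close> run inside the gap between the two pieces of the step domain. On
  such a ray the distance to a point \<open>w\<close> of the domain controls, up to a constant factor, both the
  distance of the point of the ray from \<open>0\<close> and \<open>norm w\<close>.\<close>

lemma step_domain_ray_distance:
  fixes c \<sigma> t :: real
  assumes c: "c > 0" and \<sigma>: "\<bar>\<sigma>\<bar> = 1 / (2 * c)" and t: "t \<ge> 0" and w: "w \<in> step_domain c R"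
  shows "t \<le> 2 * (1 + c) * norm (Complex t (\<sigma> * t) - w)"
    and "norm w \<le> (1 + 2 * (1 + c) * (1 + 1 / (2 * c))) * norm (Complex t (\<sigma> * t) - w)"
proof -
  define v where "v = Complex t (\<sigma> * t) - w"
  have v: "\<bar>t - Re w\<bar> \<le> norm v" "\<bar>\<sigma> * t - Im w\<bar> \<le> norm v"
    using abs_Re_le_cmod[of v] abs_Im_le_cmod[of v] by (simp_all add: v_def)
  have ct: "c * \<bar>\<sigma> * t\<bar> = t / 2" using \<sigma> c t by (simp add: abs_mult)
  have *: "c * \<bar>\<sigma> * t - Im w\<bar> \<le> c * norm v" using v(2) c by simp
  have "t \<le> 2 * (1 + c) * norm v"
    using w unfolding step_domain_def
  proof (elim CollectE conjE disjE)
    assume 1: "Re w \<le> c * \<bar>Im w\<bar>"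
    have "c * \<bar>Im w\<bar> \<le> c * \<bar>\<sigma> * t - Im w\<bar> + c * \<bar>\<sigma> * t\<bar>"
      using c by (simp add: distrib_left[symmetric])
    then have "t \<le> norm v + c * norm v + t / 2"
      using 1 * ct v(1) by linarith
    then show ?thesis by (simp add: algebra_simps)
  next
    assume "Im w = 0"
    then have "t / 2 \<le> c * norm v" using * ct by simp
    then have "t \<le> 2 * c * norm v" by simp
    also have "\<dots> \<le> 2 * (1 + c) * norm v" by (intro mult_right_mono) auto
    finally show ?thesis .
  qed
  then show t': "t \<le> 2 * (1 + c) * norm (Complex t (\<sigma> * t) - w)" by (simp add: v_def)
  have distr: "n + 2 * x * n * y = (1 + 2 * x * y) * n" for n x y :: real
    by (simp add: algebra_simps)
  have "norm w \<le> norm v + norm (Complex t (\<sigma> * t))"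
    using norm_triangle_ineq4[of "Complex t (\<sigma> * t)" v] by (simp add: v_def add.commute)
  also have "norm (Complex t (\<sigma> * t)) \<le> t + \<bar>\<sigma>\<bar> * t"
    using cmod_le[of "Complex t (\<sigma> * t)"] t by (simp add: abs_mult)
  also have "t + \<bar>\<sigma>\<bar> * t = t * (1 + 1 / (2 * c))" using \<sigma> by (simp add: algebra_simps)
  also have "\<dots> \<le> (2 * (1 + c) * norm v) * (1 + 1 / (2 * c))"
    using t' c by (intro mult_right_mono) (auto simp: v_def)
  finally show "norm w \<le> (1 + 2 * (1 + c) * (1 + 1 / (2 * c))) * norm (Complex t (\<sigma> * t) - w)"
    using distr[of "norm v" "1 + c" "1 + 1 / (2 * c)"] by (simp add: v_def)
qed

lemma poly_approximable_weighted_resolvent: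
  assumes \<zeta>: "\<zeta> \<notin> step_domain c R"
  shows "poly_approximable (\<lambda>w. w\<^sup>2) (step_domain c R) (\<lambda>w. w\<^sup>2 * (1 / (\<zeta> - w) * k))"
proof -
  let ?W = "step_domain c R"
  have 1: "poly_approximable (\<lambda>_. 1) ?W (\<lambda>w. 1 / (w - \<zeta>))"
    using poly_approximable_resolvent[OF compact_step_domain step_domain_star \<zeta>] by blast
  have 2: "poly_approximable (\<lambda>w. w\<^sup>2) ?W (\<lambda>w. w\<^sup>2 * 1)"
    using poly_approximable_poly[of "\<lambda>w. w\<^sup>2" ?W 1] by simp
  have 3: "norm (w\<^sup>2 * 1) \<le> R\<^sup>2" if "w \<in> ?W" for w
    using that by (auto simp: norm_power step_domain_def intro!: power_mono)
  from poly_approximable_mult_weight[OF 2 1 3, of 1]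
  have "poly_approximable (\<lambda>w. w\<^sup>2) ?W (\<lambda>w. w\<^sup>2 * (1 / (w - \<zeta>)))"
    using compact_imp_bounded[OF compact_step_domain] by simp
  from poly_approximable_cmult[OF this, of "- k"] show ?thesis
  proof (rule poly_approximable_cong)
    fix w assume "w \<in> ?W"
    then have "\<zeta> - w \<noteq> 0" "w - \<zeta> \<noteq> 0" using \<zeta> by auto
    then show "- k * (w\<^sup>2 * (1 / (w - \<zeta>))) = w\<^sup>2 * (1 / (\<zeta> - w) * k)"
      by (simp add: divide_simps) (simp add: algebra_simps)
  qed
qed

text \<open>Along a ray in the gap the Cauchy kernel is singular where the ray reaches \<open>0\<close>. Since
  \<open>norm w\<close> is at most a multiple of the distance from \<open>w\<close> to the ray, the factor \<open>w\<^sup>2\<close> makes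
  the integrand continuous there, with value \<open>0\<close>.\<close>

lemma poly_approximable_ray_integral:
  assumes c: "c > 0" and \<sigma>: "\<bar>\<sigma>\<bar> = 1 / (2 * c)" and a: "a = Complex L (\<sigma> * L)" and L: "L > 0"
  shows "poly_approximable (\<lambda>w. w\<^sup>2) (step_domain c R)
           (\<lambda>w. integral {0..1} (\<lambda>t. w\<^sup>2 * (1 / (of_real t * a - w) * a)))"
proof (rule poly_approximable_integral[OF compact_step_domain])
  let ?W = "step_domain c R"
  define K where "K = 1 + 2 * (1 + c) * (1 + 1 / (2 * c))"
  have K: "K > 0" using c by (simp add: K_def add_pos_pos)
  have ta: "of_real t * a = Complex (t * L) (\<sigma> * (t * L))" for t
    by (simp add: a complex_eq_iff)
  have dist: "norm w \<le> K * norm (of_real t * a - w)" "t > 0 \<Longrightarrow> of_real t * a \<noteq> w"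
    if "t \<ge> 0" "w \<in> ?W" for t w
    using step_domain_ray_distance[OF c \<sigma> _ that(2), of "t * L"] that L
    unfolding ta K_def by (auto simp: mult_le_0_iff)
  show "continuous_on ({0..1} \<times> ?W) (\<lambda>(t, w). w\<^sup>2 * (1 / (of_real t * a - w) * a))"
    unfolding continuous_on_eq_continuous_within
  proof (intro ballI)
    fix x assume x: "x \<in> {0..1::real} \<times> ?W"
    obtain t w where tw: "x = (t, w)" by (cases x)
    show "continuous (at x within {0..1} \<times> ?W) (\<lambda>(t, w). w\<^sup>2 * (1 / (of_real t * a - w) * a))"
    proof (cases "of_real t * a = w")
      case False
      then show ?thesis unfolding tw case_prod_unfold
        by (intro continuous_intros) auto
    next
      case True
      then have "w = 0" using dist(1)[of t w] x tw by auto
      moreover have "t = 0" using dist(2)[of t w] x tw True by fastforce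
      ultimately have x0: "x = (0, 0)" using tw by simp
      have "((\<lambda>(t, w). w\<^sup>2 * (1 / (of_real t * a - w) * a)) \<longlongrightarrow> 0) (at (0, 0) within {0..1::real} \<times> ?W)"
      proof (rule Lim_null_comparison)
        show "((\<lambda>x. K * norm a * norm (snd x :: complex)) \<longlongrightarrow> 0) (at (0, 0) within {0..1::real} \<times> ?W)"
          by (rule tendsto_eq_intros refl | simp)+
        have "norm (w\<^sup>2 * (1 / (of_real t * a - w) * a)) \<le> K * norm a * norm w"
          if "t \<ge> 0" "w \<in> ?W" for t w
        proof (cases "of_real t * a = w")
          case False
          have "norm w / norm (of_real t * a - w) \<le> K"
            using dist(1)[OF that] False by (simp add: divide_le_eq)
          then have "norm w / norm (of_real t * a - w) * (norm a * norm w) \<le> K * (norm a * norm w)"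
            by (rule mult_right_mono) auto
          then show ?thesis by (simp add: norm_mult norm_divide power2_eq_square mult_ac)
        qed (use K in auto)
        then show "\<forall>\<^sub>F x in at (0, 0) within {0..1} \<times> ?W.
            norm (case x of (t, w) \<Rightarrow> w\<^sup>2 * (1 / (of_real t * a - w) * a)) \<le> K * norm a * norm (snd x)"
          unfolding eventually_at_filter by (intro always_eventually) auto
      qed
      then show ?thesis by (simp add: x0 continuous_within)
    qed
  qed
  fix t :: real assume t: "0 < t" "t \<le> 1"
  have "of_real t * a \<notin> ?W" using dist(2)[of t "of_real t * a"] t by auto
  then show "poly_approximable (\<lambda>w. w\<^sup>2) ?W (\<lambda>w. w\<^sup>2 * (1 / (of_real t * a - w) * a))"
    by (rule poly_approximable_weighted_resolvent)
qed

lemma poly_approximable_segment_integral: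
  assumes disj: "closed_segment a b \<inter> step_domain c R = {}"
  shows "poly_approximable (\<lambda>w. w\<^sup>2) (step_domain c R)
           (\<lambda>w. integral {0..1} (\<lambda>t. w\<^sup>2 * (1 / (linepath a b t - w) * (b - a))))"
proof (rule poly_approximable_integral[OF compact_step_domain])
  let ?W = "step_domain c R"
  have ne: "linepath a b t \<noteq> w" if "t \<in> {0..1}" "w \<in> ?W" for t w
    using that disj linepath_image_01[of a b] by auto
  show "continuous_on ({0..1} \<times> ?W) (\<lambda>(t, w). w\<^sup>2 * (1 / (linepath a b t - w) * (b - a)))"
    unfolding case_prod_unfold linepath_def using ne unfolding linepath_def
    by (intro continuous_intros) auto
  fix t :: real assume t: "0 < t" "t \<le> 1"
  have "linepath a b t \<notin> ?W" using ne[of t "linepath a b t"] t by auto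
  then show "poly_approximable (\<lambda>w. w\<^sup>2) ?W (\<lambda>w. w\<^sup>2 * (1 / (linepath a b t - w) * (b - a)))"
    by (rule poly_approximable_weighted_resolvent)
qed

lemma interior_triangle_symmetric:
  fixes L \<sigma> r :: real
  assumes "0 < r" "r < L" "\<sigma> > 0"
  shows "complex_of_real r \<in> interior (convex hull {0, Complex L (\<sigma> * L), Complex L (- \<sigma> * L)})"
proof -
  let ?U = "{z. 0 < Re z} \<inter> {z. Re z < L} \<inter> {z. \<bar>Im z\<bar> < \<sigma> * Re z}"
  have L: "L > 0" using assms by simp
  have "?U \<subseteq> convex hull {0, Complex L (\<sigma> * L), Complex L (- \<sigma> * L)}"
  proof
    fix z assume z: "z \<in> ?U"
    define u where "u = (Re z + Im z / \<sigma>) / (2 * L)"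
    define v where "v = (Re z - Im z / \<sigma>) / (2 * L)"
    have "\<bar>Im z / \<sigma>\<bar> < Re z" using z assms by (simp add: abs_divide divide_less_eq mult.commute)
    then have "0 \<le> Re z + Im z / \<sigma>" "0 \<le> Re z - Im z / \<sigma>" by linarith+
    then have "0 \<le> u" "0 \<le> v" using L unfolding u_def v_def by (intro divide_nonneg_pos; simp)+
    moreover have "u + v = Re z / L" by (simp add: u_def v_def add_divide_distrib[symmetric])
    then have "u + v \<le> 1" using z L by simp
    moreover have "z = 0 + u *\<^sub>R (Complex L (\<sigma> * L) - 0) + v *\<^sub>R (Complex L (- \<sigma> * L) - 0)"
    proof -
      have "u * L + v * L = Re z" "u * L - v * L = Im z / \<sigma>"
        using L by (simp_all add: u_def v_def add_divide_distrib[symmetric] diff_divide_distrib[symmetric])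
      then have "u * L + v * L = Re z" "\<sigma> * (u * L - v * L) = Im z" using assms by auto
      then show ?thesis by (simp add: complex_eq_iff algebra_simps)
    qed
    ultimately show "z \<in> convex hull {0, Complex L (\<sigma> * L), Complex L (- \<sigma> * L)}"
      unfolding convex_hull_3_alt by blast
  qed
  moreover have "open ?U"
    by (intro open_Int open_Collect_less continuous_intros)
  ultimately show ?thesis
    using interior_maximal[of ?U] assms by (auto simp: subset_iff)
qed

text \<open>The step function that is \<open>1\<close> on the segment and \<open>0\<close> outside the sector is the winding number of
  a triangle that has a vertex at \<open>0\<close>, two sides in the gap and its third side beyond
  the disc. Multiplied by \<open>w\<^sup>2\<close>, its Cauchy integral is approximable side by side.\<close>

lemma step_polynomial:
  assumes c: "c > 0" and R: "R > 0" and e: "e > 0"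
  obtains q where
    "\<And>w. norm w \<le> R \<Longrightarrow> Re w \<le> c * \<bar>Im w\<bar> \<Longrightarrow> norm (w\<^sup>2 * poly q w) \<le> e"
    "\<And>w. norm w \<le> R \<Longrightarrow> Im w = 0 \<Longrightarrow> 0 \<le> Re w \<Longrightarrow> norm (w\<^sup>2 * (1 - poly q w)) \<le> e"
proof -
  define L \<sigma> where "L = R + 1" and "\<sigma> = 1 / (2 * c)"
  define a b where "a = Complex L (\<sigma> * L)" and "b = Complex L (- \<sigma> * L)"
  let ?W = "step_domain c R"
  let ?\<gamma> = "linepath 0 a +++ linepath a b +++ linepath b 0"
  have L: "L > R" "L > 0" and \<sigma>: "\<sigma> > 0" "\<bar>\<sigma>\<bar> = 1 / (2 * c)" "\<bar>- \<sigma>\<bar> = 1 / (2 * c)"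
    using R c by (auto simp: L_def \<sigma>_def)
  define H where "H w = integral {0..1} (\<lambda>t. w\<^sup>2 * (1 / (of_real t * a - w) * a))
      + integral {0..1} (\<lambda>t. w\<^sup>2 * (1 / (linepath a b t - w) * (b - a)))
      + (- 1) * integral {0..1} (\<lambda>t. w\<^sup>2 * (1 / (of_real t * b - w) * b))" for w
  have seg: "Re z = L" if z: "z \<in> closed_segment a b" for z
  proof -
    obtain u where "z = (1 - u) *\<^sub>R a + u *\<^sub>R b" using z unfolding in_segment by blast
    then show ?thesis by (simp add: a_def b_def) (simp add: algebra_simps)
  qed
  have "poly_approximable (\<lambda>w. w\<^sup>2) ?W H"
    unfolding H_def
  proof (intro poly_approximable_add poly_approximable_cmult)
    show "poly_approximable (\<lambda>w. w\<^sup>2) ?W (\<lambda>w. integral {0..1} (\<lambda>t. w\<^sup>2 * (1 / (of_real t * a - w) * a)))"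
      using poly_approximable_ray_integral[OF c \<sigma>(2) a_def L(2)] .
    show "poly_approximable (\<lambda>w. w\<^sup>2) ?W (\<lambda>w. integral {0..1} (\<lambda>t. w\<^sup>2 * (1 / (of_real t * b - w) * b)))"
      using poly_approximable_ray_integral[OF c \<sigma>(3) b_def L(2)] .
    have "z \<notin> ?W" if "z \<in> closed_segment a b" for z
      using seg[OF that] L(1) abs_Re_le_cmod[of z] by (auto simp: step_domain_def)
    then show "poly_approximable (\<lambda>w. w\<^sup>2) ?W (\<lambda>w. integral {0..1} (\<lambda>t. w\<^sup>2 * (1 / (linepath a b t - w) * (b - a))))"
      by (intro poly_approximable_segment_integral) blast
  qed
  then obtain q where q: "\<And>w. w \<in> ?W \<Longrightarrow> norm (H w - w\<^sup>2 * poly q w) < 2 * pi * e"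
    using poly_approximableD[of _ _ H "2 * pi * e"] e by (metis mult_pos_pos pi_gt_zero zero_less_numeral)

  have ray: "z \<notin> ?W - {0}" if z: "z \<in> closed_segment 0 (Complex L (\<tau> * L))" and \<tau>: "\<bar>\<tau>\<bar> = 1 / (2 * c)" for z \<tau>
  proof
    assume zW: "z \<in> ?W - {0}"
    obtain t where t: "0 \<le> t" "z = Complex (t * L) (\<tau> * (t * L))"
      using z by (auto simp: closed_segment_def complex_eq_iff algebra_simps)
    have "t * L \<le> 0" using step_domain_ray_distance(1)[OF c \<tau>, of "t * L" z R] t L zW by auto
    then have "z = 0" using t L by (simp add: mult_le_0_iff complex_eq_iff)
    then show False using zW by simp
  qed
  have H: "H w = w\<^sup>2 * (2 * pi * \<i> * winding_number ?\<gamma> w)" if w: "w \<in> ?W" "w \<noteq> 0" for w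
  proof -
    have seg0: "w \<notin> closed_segment 0 a" "w \<notin> closed_segment 0 b" "w \<notin> closed_segment a b"
      using ray[of w \<sigma>] ray[of w "- \<sigma>"] \<sigma> w seg[of w] L(1) abs_Re_le_cmod[of w]
      by (auto simp: a_def b_def step_domain_def)
    then have seg1: "w \<notin> closed_segment b 0" by (simp add: closed_segment_commute)
    have int: "(\<lambda>z. 1 / (z - w)) contour_integrable_on linepath x y" if "w \<notin> closed_segment x y" for x y
      using that by (intro contour_integrable_inversediff) auto
    have "contour_integral (linepath b 0) (\<lambda>z. 1 / (z - w)) = - contour_integral (linepath 0 b) (\<lambda>z. 1 / (z - w))"
      using contour_integral_reversepath[of "linepath 0 b" "\<lambda>z. 1 / (z - w)"] by simp
    then have "contour_integral ?\<gamma> (\<lambda>z. 1 / (z - w)) =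
        contour_integral (linepath 0 a) (\<lambda>z. 1 / (z - w)) + contour_integral (linepath a b) (\<lambda>z. 1 / (z - w))
        - contour_integral (linepath 0 b) (\<lambda>z. 1 / (z - w))"
      using int seg0 seg1 by simp
    also have "\<dots> = integral {0..1} (\<lambda>t. 1 / (of_real t * a - w) * a)
       + integral {0..1} (\<lambda>t. 1 / (linepath a b t - w) * (b - a))
       - integral {0..1} (\<lambda>t. 1 / (of_real t * b - w) * b)"
    proof -
      have "linepath 0 x t = of_real t * x" for x :: complex and t
        by (simp add: linepath_def scaleR_conv_of_real)
      then show ?thesis by (simp add: contour_integral_integral)
    qed
    finally have "w\<^sup>2 * contour_integral ?\<gamma> (\<lambda>z. 1 / (z - w)) = H w"
      unfolding H_def integral_mult_right by (simp only:) (simp only: distrib_left right_diff_distrib, simp)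
    moreover have "winding_number ?\<gamma> w = 1 / (2 * pi * \<i>) * contour_integral ?\<gamma> (\<lambda>z. 1 / (z - w))"
      using seg0 seg1 by (intro winding_number_valid_path) (auto simp: path_image_join)
    ultimately show ?thesis by simp
  qed
  \<comment> \<open>The sign accounts for the triangle being traversed clockwise.\<close>
  define k where "k = - 1 / (2 * pi * \<i>)"
  have k: "norm (k * (H w - w\<^sup>2 * poly q w)) \<le> e" if "w \<in> ?W" for w
  proof -
    have "norm k = 1 / (2 * pi)" by (simp add: k_def norm_divide norm_mult)
    then have "norm (k * (H w - w\<^sup>2 * poly q w)) \<le> 1 / (2 * pi) * (2 * pi * e)"
      unfolding norm_mult using q[OF that] by (intro mult_mono) auto
    then show ?thesis by simp
  qed
  show thesis
  proof (rule that)
    fix w :: complex assume w: "norm w \<le> R" "Im w = 0" "0 \<le> Re w"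
    have W: "w \<in> ?W" using w by (simp add: step_domain_def)
    show "norm (w\<^sup>2 * (1 - poly (smult k q) w)) \<le> e"
    proof (cases "w = 0")
      case False
      define r where "r = Re w"
      have wr: "w = of_real r" using w by (simp add: r_def complex_eq_iff)
      have r: "0 < r" "r < L" using w False L wr by auto
      have "w \<in> interior (convex hull {0, a, b})"
        unfolding wr a_def b_def by (rule interior_triangle_symmetric[OF r \<sigma>(1)])
      moreover have "\<not> 0 < Im ((a - 0) * cnj (a - w))"
        using mult_pos_pos[OF L(2) mult_pos_pos[OF \<sigma>(1) r(1)]] by (simp add: wr a_def algebra_simps)
      ultimately have "winding_number ?\<gamma> w = - 1"
        using winding_number_triangle[of w 0 a b] by simp
      then have "k * H w = w\<^sup>2" using H[OF W False] by (simp add: k_def)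
      then have "w\<^sup>2 * (1 - poly (smult k q) w) = k * (H w - w\<^sup>2 * poly q w)"
        by (simp add: algebra_simps)
      then show ?thesis using k[OF W] by simp
    qed (use e in simp)
  next
    fix w assume w: "norm w \<le> R" "Re w \<le> c * \<bar>Im w\<bar>"
    have W: "w \<in> ?W" using w by (simp add: step_domain_def)
    show "norm (w\<^sup>2 * poly (smult k q) w) \<le> e"
    proof (cases "w = 0")
      case False
      let ?s = "{z. Im z \<le> \<sigma> * Re z} \<inter> {z. - Im z \<le> \<sigma> * Re z}"
      have "convex ?s"
        unfolding convex_alt
      proof (intro ballI allI impI)
        fix x y :: complex and u :: real
        assume xy: "x \<in> ?s" "y \<in> ?s" and u: "0 \<le> u \<and> u \<le> 1"
        have "(1 - u) * Im x + u * Im y \<le> (1 - u) * (\<sigma> * Re x) + u * (\<sigma> * Re y)"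
          "(1 - u) * (- Im x) + u * (- Im y) \<le> (1 - u) * (\<sigma> * Re x) + u * (\<sigma> * Re y)"
          using xy u by (intro add_mono mult_left_mono; simp)+
        then show "(1 - u) *\<^sub>R x + u *\<^sub>R y \<in> ?s" by (simp add: algebra_simps)
      qed
      moreover have "w \<notin> ?s"
      proof
        assume s: "w \<in> ?s"
        then have 1: "\<bar>Im w\<bar> \<le> \<sigma> * Re w" by auto
        then have "0 \<le> \<sigma> * Re w" by linarith
        then have "Re w \<ge> 0" using \<sigma>(1) by (simp add: zero_le_mult_iff)
        moreover have "Re w \<le> Re w / 2"
          using w(2) mult_left_mono[OF 1, of c] c by (simp add: \<sigma>_def)
        ultimately show False using 1 False by (auto simp: complex_eq_iff)
      qed
      moreover have "path_image ?\<gamma> \<subseteq> ?s"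
      proof -
        have "0 \<in> ?s" "a \<in> ?s" "b \<in> ?s" using \<sigma>(1) L by (auto simp: a_def b_def)
        then have "closed_segment 0 a \<subseteq> ?s" "closed_segment a b \<subseteq> ?s" "closed_segment b 0 \<subseteq> ?s"
          using \<open>convex ?s\<close> by (simp_all only: closed_segment_subset)
        then show ?thesis by (simp add: path_image_join)
      qed
      ultimately have "winding_number ?\<gamma> w = 0"
        by (intro winding_number_zero_outside[of ?\<gamma> ?s]) auto
      then have "H w = 0" using H[OF W False] by simp
      then show ?thesis using k[OF W] by (simp add: norm_mult mult_ac)
    qed (use e in simp)
  qed
qed

section \<open>Kallin's lemma for a ray and the outside of a sector\<close>

definition polynomial2 :: "(complex ^ 2 \<Rightarrow> complex) \<Rightarrow> bool" where
  "polynomial2 F \<longleftrightarrow> (\<exists>p. \<forall>z. eval2 p z = F z)"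

lemma polynomial2_const: "polynomial2 (\<lambda>_. c)"
  unfolding polynomial2_def by (intro exI[of _ "[:[:c:]:]"]) (simp add: eval2_def)

lemma polynomial2_nth: "polynomial2 (\<lambda>z. z $ j)"
proof -
  have "polynomial2 (\<lambda>z. z $ 1)"
    unfolding polynomial2_def by (intro exI[of _ "[:[:0, 1:]:]"]) (simp add: eval2_def)
  moreover have "polynomial2 (\<lambda>z. z $ 2)"
    unfolding polynomial2_def by (intro exI[of _ "[:0, 1:]"]) (simp add: eval2_def)
  ultimately show ?thesis using exhaust_2[of j] by auto
qed

lemma polynomial2_add: "polynomial2 F \<Longrightarrow> polynomial2 G \<Longrightarrow> polynomial2 (\<lambda>z. F z + G z)"
  unfolding polynomial2_def eval2_def by (metis poly_add)

lemma polynomial2_mult: "polynomial2 F \<Longrightarrow> polynomial2 G \<Longrightarrow> polynomial2 (\<lambda>z. F z * G z)"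
  unfolding polynomial2_def eval2_def by (metis poly_mult)

lemma polynomial2_diff:
  assumes "polynomial2 F" "polynomial2 G"
  shows "polynomial2 (\<lambda>z. F z - G z)"
  using polynomial2_add[OF assms(1) polynomial2_mult[OF polynomial2_const[of "-1"] assms(2)]] by simp

lemma polynomial2_power: "polynomial2 F \<Longrightarrow> polynomial2 (\<lambda>z. F z ^ n)"
  by (induction n) (auto intro: polynomial2_const polynomial2_mult)

lemma polynomial2_poly: "polynomial2 F \<Longrightarrow> polynomial2 (\<lambda>z. poly q (F z))"
  by (induction q) (auto intro!: polynomial2_const polynomial2_mult polynomial2_add)

lemmas polynomial2_intros = polynomial2_const polynomial2_nth polynomial2_add polynomial2_mult
  polynomial2_diff polynomial2_power polynomial2_poly

lemma continuous_on_eval2: "continuous_on S (eval2 p)"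
proof (induction p)
  case (pCons a p)
  have "eval2 (pCons a p) = (\<lambda>z. poly a (z $ 1) + z $ 2 * eval2 p z)"
    by (auto simp: eval2_def)
  then show ?case using pCons by (auto intro!: continuous_intros)
qed (simp add: eval2_def)

lemma polynomial2_continuous_on: "polynomial2 F \<Longrightarrow> continuous_on S F"
  unfolding polynomial2_def using continuous_on_eval2 by (metis ext)

lemma polynomial2_bounded_on_compact:
  assumes "polynomial2 F" "compact K"
  obtains B where "B \<ge> 0" "\<And>z. z \<in> K \<Longrightarrow> norm (F z) \<le> B"
proof -
  have "bounded (F ` K)"
    using assms by (intro compact_imp_bounded compact_continuous_image polynomial2_continuous_on)
  then obtain B where "B > 0" "\<forall>x\<in>F ` K. norm x \<le> B" by (auto simp: bounded_pos)
  then show thesis using that[of B] by auto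
qed

lemma polynomially_convexI:
  assumes K: "compact K" "K \<noteq> {}"
    and sep: "\<And>z. z \<notin> K \<Longrightarrow> \<exists>F r. polynomial2 F \<and> (\<forall>w\<in>K. norm (F w) \<le> r) \<and> r < norm (F z)"
  shows "polynomially_convex K"
  unfolding polynomially_convex_def
proof (intro conjI K set_eqI iffI)
  fix z assume z: "z \<in> K"
  have "norm (eval2 p z) \<le> (SUP w\<in>K. norm (eval2 p w))" for p
  proof (rule cSUP_upper[OF z])
    have "polynomial2 (eval2 p)" unfolding polynomial2_def by blast
    from polynomial2_bounded_on_compact[OF this K(1)]
    show "bdd_above ((\<lambda>w. norm (eval2 p w)) ` K)" by (metis bdd_aboveI2)
  qed
  then show "z \<in> {z. \<forall>p. norm (eval2 p z) \<le> (SUP w\<in>K. norm (eval2 p w))}" by blast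
next
  fix z assume z: "z \<in> {z. \<forall>p. norm (eval2 p z) \<le> (SUP w\<in>K. norm (eval2 p w))}"
  show "z \<in> K"
  proof (rule ccontr)
    assume "z \<notin> K"
    then obtain p r where p: "\<And>w. w \<in> K \<Longrightarrow> norm (eval2 p w) \<le> r" "r < norm (eval2 p z)"
      using sep unfolding polynomial2_def by (metis ext)
    have "(SUP w\<in>K. norm (eval2 p w)) \<le> r" using K(2) p(1) by (rule cSUP_least)
    then show False using z p(2) by (metis (mono_tags, lifting) mem_Collect_eq not_less order_trans)
  qed
qed

lemma polynomially_convex_separation:
  assumes K: "polynomially_convex K" "K \<noteq> {}" and z: "z \<notin> K"
  obtains F r where "polynomial2 F" "F z = 1" "0 \<le> r" "r < 1" "\<And>w. w \<in> K \<Longrightarrow> norm (F w) \<le> r"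
proof -
  let ?s = "\<lambda>p. SUP w\<in>K. norm (eval2 p w)"
  have cK: "compact K" using K by (simp add: polynomially_convex_def)
  have hull: "K = {z. \<forall>p. norm (eval2 p z) \<le> ?s p}"
    using K(1) unfolding polynomially_convex_def by (rule conjunct2)
  have "z \<notin> {z. \<forall>p. norm (eval2 p z) \<le> ?s p}"
    by (subst hull[symmetric]) (rule z)
  then obtain p where p: "?s p < norm (eval2 p z)"
    by (auto simp: not_le)
  have poly: "polynomial2 (eval2 p)" unfolding polynomial2_def by blast
  have bdd: "bdd_above ((\<lambda>w. norm (eval2 p w)) ` K)"
    using polynomial2_bounded_on_compact[OF poly cK] by (metis bdd_aboveI2)
  have le: "norm (eval2 p w) \<le> ?s p" if "w \<in> K" for w
    using cSUP_upper[OF that bdd] .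
  obtain w0 where "w0 \<in> K" using K(2) by blast
  then have s0: "?s p \<ge> 0" using le[of w0] norm_ge_zero order_trans by blast
  show thesis
  proof (rule that)
    show "polynomial2 (\<lambda>w. (1 / eval2 p z) * eval2 p w)"
      by (intro polynomial2_intros poly)
    show "(1 / eval2 p z) * eval2 p z = 1" "0 \<le> ?s p / norm (eval2 p z)" "?s p / norm (eval2 p z) < 1"
      using p s0 order_le_less_trans[OF s0 p] by (auto simp: divide_less_eq)
    show "norm ((1 / eval2 p z) * eval2 p w) \<le> ?s p / norm (eval2 p z)" if "w \<in> K" for w
      using le[OF that] by (simp add: norm_mult norm_divide divide_right_mono)
  qed
qed

text \<open>The factor \<open>P\<^sup>2\<close> in the bounds comes from the fourth power of a linear form, normalised at
  \<open>z0 \<noteq> 0\<close>; the small constant on \<open>K'\<close> comes from a high power of a separating polynomial, whose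
  size on the larger set \<open>K\<close> cannot be controlled but is at least finite.\<close>

lemma weighted_separation:
  fixes P :: "complex ^ 2 \<Rightarrow> complex"
  assumes K: "compact K" and K': "polynomially_convex K'" "K' \<noteq> {}" "K' \<subseteq> K"
    and z0: "z0 \<notin> K'" "z0 \<noteq> 0" and \<tau>: "\<tau> > 0"
    and P: "\<And>z. z \<in> K \<Longrightarrow> (norm z)\<^sup>2 \<le> C * norm (P z)"
  obtains f M where "polynomial2 f" "f z0 = 1" "M \<ge> 0"
    "\<And>z. z \<in> K' \<Longrightarrow> norm (f z) \<le> \<tau> * (norm (P z))\<^sup>2"
    "\<And>z. z \<in> K \<Longrightarrow> norm (f z) \<le> M * (norm (P z))\<^sup>2"
proof -
  obtain F r where F: "polynomial2 F" "F z0 = 1" "0 \<le> r" "r < 1" "\<And>w. w \<in> K' \<Longrightarrow> norm (F w) \<le> r"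
    using polynomially_convex_separation[OF K'(1,2) z0(1)] by blast
  obtain j where j: "z0 $ j \<noteq> 0" using z0(2) by (auto simp: vec_eq_iff)
  define l where "l z = (1 / z0 $ j) * z $ j" for z :: "complex ^ 2"
  define D where "D = (C / (norm (z0 $ j))\<^sup>2)\<^sup>2"
  have D: "D \<ge> 0" by (simp add: D_def)
  have l: "norm (l z ^ 4) \<le> D * (norm (P z))\<^sup>2" if "z \<in> K" for z
  proof -
    have "(norm (z $ j))\<^sup>2 \<le> (norm z)\<^sup>2" by (intro power_mono Finite_Cartesian_Product.norm_nth_le) auto
    also have "\<dots> \<le> C * norm (P z)" by (rule P[OF that])
    finally have "(norm (z $ j))\<^sup>2 / (norm (z0 $ j))\<^sup>2 \<le> C * norm (P z) / (norm (z0 $ j))\<^sup>2"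
      by (rule divide_right_mono) simp
    then have "(norm (l z))\<^sup>2 \<le> C / (norm (z0 $ j))\<^sup>2 * norm (P z)"
      by (simp add: l_def norm_mult norm_divide power_divide)
    then have "((norm (l z))\<^sup>2)\<^sup>2 \<le> (C / (norm (z0 $ j))\<^sup>2 * norm (P z))\<^sup>2"
      by (rule power_mono) simp
    then show ?thesis by (simp add: D_def norm_power power_mult_distrib power_divide flip: power_mult)
  qed
  obtain m where m: "r ^ m < \<tau> / (D + 1)"
    using real_arch_pow_inv[of "\<tau> / (D + 1)" r] F(4) \<tau> D by auto
  have mD: "r ^ m * D \<le> \<tau>"
  proof -
    have "r ^ m * D \<le> \<tau> / (D + 1) * D" using m D by (intro mult_right_mono) auto
    also have "\<dots> \<le> \<tau>" using D \<tau> by (simp add: field_simps)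
    finally show ?thesis .
  qed
  have Fm: "polynomial2 (\<lambda>z. F z ^ m)" by (intro polynomial2_intros F)
  obtain B where B: "B \<ge> 0" "\<And>z. z \<in> K \<Longrightarrow> norm (F z ^ m) \<le> B"
    using polynomial2_bounded_on_compact[OF Fm K] by blast
  show thesis
  proof (rule that)
    show "polynomial2 (\<lambda>z. F z ^ m * l z ^ 4)" unfolding l_def by (intro polynomial2_intros F)
    show "F z0 ^ m * l z0 ^ 4 = 1" using F(2) j by (simp add: l_def)
    show "B * D \<ge> 0" using B D by simp
    fix z
    show "norm (F z ^ m * l z ^ 4) \<le> B * D * (norm (P z))\<^sup>2" if z: "z \<in> K"
      unfolding norm_mult[of "F z ^ m"] using mult_mono[OF B(2)[OF z] l[OF z]] B(1) by (simp add: mult_ac)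
    show "norm (F z ^ m * l z ^ 4) \<le> \<tau> * (norm (P z))\<^sup>2" if z: "z \<in> K'"
    proof -
      have "norm (F z ^ m) \<le> r ^ m" unfolding norm_power by (intro power_mono F(5) z) auto
      then have "norm (F z ^ m * l z ^ 4) \<le> r ^ m * (D * (norm (P z))\<^sup>2)"
        unfolding norm_mult[of "F z ^ m"] using l[of z] z K'(3) F(3) by (intro mult_mono) auto
      also have "\<dots> \<le> \<tau> * (norm (P z))\<^sup>2"
        unfolding mult.assoc[symmetric] by (intro mult_right_mono mD) auto
      finally show ?thesis .
    qed
  qed
qed

text \<open>A case of Kallin's lemma. For \<open>z0\<close> outside \<open>K1 \<union> K2\<close> take polynomials \<open>f1\<close>, \<open>f2\<close> with value \<open>1\<close>
  at \<open>z0\<close> and small on \<open>K1\<close> and \<open>K2\<close> respectively, and glue them by a polynomial \<open>q\<close> close to the step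
  function: \<open>f1 * q(P) + f2 * (1 - q(P))\<close> still has value \<open>1\<close> at \<open>z0\<close>, whatever \<open>P z0\<close> is. The step
  polynomial is controlled only after multiplication by \<open>w\<^sup>2\<close>; this suffices because \<open>f1\<close> and \<open>f2\<close>
  are bounded by multiples of \<open>P\<^sup>2\<close> on \<open>K1 \<union> K2\<close>. That in turn is possible because \<open>P\<close> vanishes on
  this union at \<open>0\<close> only, quadratically.\<close>

theorem polynomially_convex_Un_ray_sector:
  assumes K1: "polynomially_convex K1" "0 \<in> K1" and K2: "polynomially_convex K2" "0 \<in> K2"
    and P: "polynomial2 P" and c: "c > 0"
    and ray: "\<And>z. z \<in> K1 \<Longrightarrow> Im (P z) = 0 \<and> 0 \<le> Re (P z)"
    and sector: "\<And>z. z \<in> K2 \<Longrightarrow> Re (P z) \<le> c * \<bar>Im (P z)\<bar>"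
    and P0: "\<And>z. z \<in> K1 \<union> K2 \<Longrightarrow> (norm z)\<^sup>2 \<le> C * norm (P z)"
  shows "polynomially_convex (K1 \<union> K2)"
proof (rule polynomially_convexI)
  let ?K = "K1 \<union> K2"
  show cK: "compact ?K" using K1 K2 by (auto simp: polynomially_convex_def)
  show "?K \<noteq> {}" using K1 by auto
  fix z0 assume z0: "z0 \<notin> ?K"
  then have ne: "z0 \<noteq> 0" "z0 \<notin> K1" "z0 \<notin> K2" using K1 by auto
  obtain R0 where R0: "R0 \<ge> 0" "\<And>z. z \<in> ?K \<Longrightarrow> norm (P z) \<le> R0"
    using polynomial2_bounded_on_compact[OF P cK] by blast
  define R where "R = R0 + 1"
  have R: "R > 0" "\<And>z. z \<in> ?K \<Longrightarrow> norm (P z) \<le> R" using R0 by (force simp: R_def)+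
  define \<tau> where "\<tau> = 1 / (4 * (R\<^sup>2 + 1))"
  have R2: "R\<^sup>2 + 1 > 0" by (simp add: add_nonneg_pos)
  then have \<tau>: "\<tau> > 0" "\<tau> * (R\<^sup>2 + 1) = 1 / 4" by (auto simp: \<tau>_def)
  obtain f1 M1 where f1: "polynomial2 f1" "f1 z0 = 1" "M1 \<ge> 0"
    "\<And>z. z \<in> K1 \<Longrightarrow> norm (f1 z) \<le> \<tau> * (norm (P z))\<^sup>2"
    "\<And>z. z \<in> ?K \<Longrightarrow> norm (f1 z) \<le> M1 * (norm (P z))\<^sup>2"
    using weighted_separation[OF cK K1(1) _ _ ne(2,1) \<tau>(1) P0] K1(2) by auto
  obtain f2 M2 where f2: "polynomial2 f2" "f2 z0 = 1" "M2 \<ge> 0"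
    "\<And>z. z \<in> K2 \<Longrightarrow> norm (f2 z) \<le> \<tau> * (norm (P z))\<^sup>2"
    "\<And>z. z \<in> ?K \<Longrightarrow> norm (f2 z) \<le> M2 * (norm (P z))\<^sup>2"
    using weighted_separation[OF cK K2(1) _ _ ne(3,1) \<tau>(1) P0] K2(2) by auto
  \<comment> \<open>The accuracy of the step is chosen last: \<open>M1\<close> and \<open>M2\<close> depend on \<open>\<tau>\<close>, but \<open>\<tau>\<close> depends on \<open>R\<close> only.\<close>
  define e where "e = 1 / (4 * (M1 + M2 + 1))"
  have e: "e > 0" "e \<le> 1" "M1 * e \<le> 1 / 4" "M2 * e \<le> 1 / 4"
    using f1(3) f2(3) by (auto simp: e_def field_simps)
  obtain q where q: "\<And>w. norm w \<le> R \<Longrightarrow> Re w \<le> c * \<bar>Im w\<bar> \<Longrightarrow> norm (w\<^sup>2 * poly q w) \<le> e"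
    "\<And>w. norm w \<le> R \<Longrightarrow> Im w = 0 \<Longrightarrow> 0 \<le> Re w \<Longrightarrow> norm (w\<^sup>2 * (1 - poly q w)) \<le> e"
    using step_polynomial[OF c R(1) e(1)] by blast
  define F where "F z = f1 z * poly q (P z) + f2 z * (1 - poly q (P z))" for z
  \<comment> \<open>On either set, \<open>f\<close> is the polynomial that is small there and \<open>v\<close> is the part of the step that is small there.\<close>
  have bound: "norm (f z * u + g z * v) \<le> 1 / 2"
    if "norm (f z) \<le> \<tau> * (norm (P z))\<^sup>2" "norm (g z) \<le> M * (norm (P z))\<^sup>2" "M * e \<le> 1 / 4" "M \<ge> 0"
      "u + v = 1" "norm ((P z)\<^sup>2 * v) \<le> e" "norm (P z) \<le> R" for f g :: "complex ^ 2 \<Rightarrow> complex" and u v z M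
  proof -
    have "norm (f z * u) \<le> \<tau> * (norm (P z))\<^sup>2 * norm u"
      unfolding norm_mult by (intro mult_right_mono that) auto
    also have "\<dots> = \<tau> * norm ((P z)\<^sup>2 * u)" by (simp add: norm_mult norm_power)
    also have "(P z)\<^sup>2 * u = (P z)\<^sup>2 - (P z)\<^sup>2 * v" using that(5) by (metis add_diff_cancel_right' distrib_left mult.right_neutral)
    also have "\<tau> * norm \<dots> \<le> \<tau> * (R\<^sup>2 + 1)"
    proof (intro mult_left_mono)
      have "norm ((P z)\<^sup>2) \<le> R\<^sup>2" unfolding norm_power by (intro power_mono that) auto
      then show "norm ((P z)\<^sup>2 - (P z)\<^sup>2 * v) \<le> R\<^sup>2 + 1"
        using norm_triangle_ineq4[of "(P z)\<^sup>2" "(P z)\<^sup>2 * v"] that(6) e(2) by linarith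
    qed (use \<tau> in auto)
    finally have 1: "norm (f z * u) \<le> 1 / 4" using \<tau>(2) by simp
    have "norm (g z * v) \<le> M * (norm (P z))\<^sup>2 * norm v"
      unfolding norm_mult by (intro mult_right_mono that) auto
    also have "\<dots> = M * norm ((P z)\<^sup>2 * v)" by (simp add: norm_mult norm_power)
    also have "\<dots> \<le> M * e" by (intro mult_left_mono that)
    finally have "norm (g z * v) \<le> 1 / 4" using that(3) by simp
    then show ?thesis using 1 norm_triangle_ineq[of "f z * u" "g z * v"] by linarith
  qed
  have "norm (F z) \<le> 1 / 2" if "z \<in> ?K" for z
  proof (cases "z \<in> K1")
    case True
    show ?thesis unfolding F_def
      using True that ray[OF True]
      by (intro bound[where M = M2] f1(4) f2(5) q(2) R(2) e(4) f2(3)) auto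
  next
    case False
    then have z: "z \<in> K2" using that by auto
    have "norm (f2 z * (1 - poly q (P z)) + f1 z * poly q (P z)) \<le> 1 / 2"
      using z that sector[OF z]
      by (intro bound[where M = M1] f2(4) f1(5) q(1) R(2) e(3) f1(3)) auto
    then show ?thesis by (simp add: F_def add.commute)
  qed
  moreover have "F z0 = 1" using f1(2) f2(2) by (simp add: F_def)
  moreover have "polynomial2 F" unfolding F_def by (intro polynomial2_intros P f1 f2)
  ultimately show "\<exists>F r. polynomial2 F \<and> (\<forall>w\<in>?K. norm (F w) \<le> r) \<and> r < norm (F z0)"
    by (intro exI[of _ F] exI[of _ "1/2"]) auto
qed

section \<open>Quadratic forms on totally real planes\<close>

lemma real_plane_iff: "z \<in> real_plane \<longleftrightarrow> (\<forall>j. Im (z $ j) = 0)"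
proof
  assume z: "\<forall>j. Im (z $ j) = 0"
  have "z = of_real_vec (\<chi> j. Re (z $ j))"
    using z by (simp add: of_real_vec_def vec_eq_iff complex_eq_iff)
  then show "z \<in> real_plane" by (auto simp: real_plane_def)
qed (auto simp: real_plane_def of_real_vec_def)

lemma norm_of_real_vec: "norm (of_real_vec x) = norm x"
  by (simp add: norm_vec_def of_real_vec_def)

lemma closed_real_plane: "closed real_plane"
proof -
  have "real_plane = (\<Inter>j. {z. Im (z $ j) = 0})" using real_plane_iff by auto
  moreover have "closed (\<Inter>j. {z :: complex ^ 2. Im (z $ j) = 0})"
    by (intro closed_INT ballI closed_Collect_eq continuous_intros)
  ultimately show ?thesis by (simp only:)
qed

text \<open>A real point outside the ball is separated by the linear form of the inner product with it. A
  point with \<open>Im (z $ j) \<noteq> 0\<close> is separated by \<open>(B + 1) - (w $ j - Re (z $ j))\<^sup>2\<close>: the square is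
  between \<open>0\<close> and \<open>B\<close> on the real part of the ball and negative at \<open>z\<close>.\<close>

lemma polynomially_convex_real_ball:
  assumes r: "r > 0"
  shows "polynomially_convex (real_plane \<inter> cball 0 r)"
proof (rule polynomially_convexI)
  let ?K = "real_plane \<inter> cball (0 :: complex ^ 2) r"
  show cK: "compact ?K" by (rule closed_Int_compact[OF closed_real_plane compact_cball])
  have "0 \<in> ?K" using r by (simp add: real_plane_iff)
  then show "?K \<noteq> {}" by blast
  fix z assume z: "z \<notin> ?K"
  show "\<exists>F s. polynomial2 F \<and> (\<forall>w\<in>?K. norm (F w) \<le> s) \<and> s < norm (F z)"
  proof (cases "z \<in> real_plane")
    case True
    then obtain x where x: "z = of_real_vec x" by (auto simp: real_plane_def)
    have nx: "norm x > r" using z True x by (auto simp: norm_of_real_vec)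
    define F where "F w = of_real (x $ 1) * w $ 1 + of_real (x $ 2) * w $ 2" for w :: "complex ^ 2"
    have F: "F (of_real_vec y) = of_real (inner x y)" for y
      by (simp add: F_def of_real_vec_def inner_vec_def sum_2)
    have "polynomial2 F" unfolding F_def by (intro polynomial2_intros)
    moreover have "norm (F w) \<le> norm x * r" if w: "w \<in> ?K" for w
    proof -
      obtain y where y: "w = of_real_vec y" using w by (auto simp: real_plane_def)
      then have "norm y \<le> r" using w by (simp add: norm_of_real_vec)
      then have "\<bar>inner x y\<bar> \<le> norm x * r"
        using Cauchy_Schwarz_ineq2[of x y] by (meson mult_left_mono norm_ge_zero order_trans)
      then show ?thesis by (simp add: y F)
    qed
    moreover have "norm x * r < norm (F z)"
    proof -
      have "norm (F z) = norm x * norm x"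
        by (simp add: x F norm_mult dot_square_norm power2_eq_square)
      moreover have "norm x * r < norm x * norm x"
        using nx r by (intro mult_strict_left_mono) auto
      ultimately show ?thesis by simp
    qed
    ultimately show ?thesis by blast
  next
    case False
    then obtain j where j: "Im (z $ j) \<noteq> 0" by (auto simp: real_plane_iff)
    define S where "S w = (w $ j - of_real (Re (z $ j)))\<^sup>2" for w :: "complex ^ 2"
    have S: "polynomial2 S" unfolding S_def by (intro polynomial2_intros)
    obtain B where B: "B \<ge> 0" "\<And>w. w \<in> ?K \<Longrightarrow> norm (S w) \<le> B"
      using polynomial2_bounded_on_compact[OF S cK] by blast
    define F where "F w = of_real (B + 1) - S w" for w
    have "polynomial2 F" unfolding F_def by (intro polynomial2_intros S)
    moreover have "norm (F w) \<le> B + 1" if w: "w \<in> ?K" for w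
    proof -
      define u where "u = (Re (w $ j) - Re (z $ j))\<^sup>2"
      have "w $ j = of_real (Re (w $ j))" using w by (auto simp: real_plane_iff complex_eq_iff)
      then have Sw: "S w = of_real u" unfolding S_def u_def by (metis of_real_diff of_real_power)
      have u: "0 \<le> u" by (simp add: u_def)
      then have "norm (S w) = u" unfolding Sw norm_of_real by simp
      then have "u \<le> B" "F w = of_real (B + 1 - u)"
        using B(2)[OF w] by (simp_all add: F_def Sw)
      with u show ?thesis by (simp only: norm_of_real)
    qed
    moreover have "B + 1 < norm (F z)"
    proof -
      have "z $ j - of_real (Re (z $ j)) = \<i> * of_real (Im (z $ j))" by (simp add: complex_eq_iff)
      then have "S z = - of_real ((Im (z $ j))\<^sup>2)" by (simp add: S_def power_mult_distrib)
      then have Fz: "F z = of_real (B + 1 + (Im (z $ j))\<^sup>2)" by (simp add: F_def)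
      have "(Im (z $ j))\<^sup>2 > 0" using j by simp
      then show ?thesis unfolding Fz norm_of_real by linarith
    qed
    ultimately show ?thesis by blast
  qed
qed

definition quad_form :: "real \<Rightarrow> real \<Rightarrow> real \<Rightarrow> complex ^ 2 \<Rightarrow> complex" where
  "quad_form \<alpha> \<beta> \<gamma> z = of_real \<alpha> * (z $ 1)\<^sup>2 + 2 * of_real \<beta> * (z $ 1 * z $ 2) + of_real \<gamma> * (z $ 2)\<^sup>2"

lemma polynomial2_quad_form: "polynomial2 (quad_form \<alpha> \<beta> \<gamma>)"
  unfolding quad_form_def by (intro polynomial2_intros)

text \<open>For the symmetric matrix \<open>G\<close> of the form with trace \<open>\<alpha> + \<gamma>\<close>, the difference of the two sides is
  the square of the norm of \<open>G (x, y)\<close>, by the Cayley--Hamilton theorem for \<open>G\<close>.\<close>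

lemma positive_definite_lower_bound:
  fixes \<alpha> \<beta> \<gamma> x y :: real
  assumes "\<alpha> > 0" "\<alpha> * \<gamma> - \<beta>\<^sup>2 > 0"
  shows "\<gamma> > 0"
    and "(\<alpha> * \<gamma> - \<beta>\<^sup>2) * (x\<^sup>2 + y\<^sup>2) \<le> (\<alpha> + \<gamma>) * (\<alpha> * x\<^sup>2 + 2 * \<beta> * (x * y) + \<gamma> * y\<^sup>2)"
proof -
  have "\<alpha> * \<gamma> > 0" using assms(2) zero_le_power2[of \<beta>] by linarith
  then show "\<gamma> > 0" using assms(1) by (simp add: zero_less_mult_iff)
  have "0 \<le> (\<alpha> * x + \<beta> * y)\<^sup>2 + (\<beta> * x + \<gamma> * y)\<^sup>2" by simp
  then show "(\<alpha> * \<gamma> - \<beta>\<^sup>2) * (x\<^sup>2 + y\<^sup>2) \<le> (\<alpha> + \<gamma>) * (\<alpha> * x\<^sup>2 + 2 * \<beta> * (x * y) + \<gamma> * y\<^sup>2)"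
    by (simp add: power2_eq_square algebra_simps)
qed

lemma shifted_planeE:
  assumes "z \<in> shifted_plane A"
  obtains x y where
    "z $ 1 = Complex (A $ 1 $ 1 * x + A $ 1 $ 2 * y) x"
    "z $ 2 = Complex (A $ 2 $ 1 * x + A $ 2 $ 2 * y) y"
proof -
  obtain v where v: "z = (of_real_mat A + mat \<i>) *v of_real_vec v"
    using assms by (auto simp: shifted_plane_def real_plane_def)
  show thesis
    by (rule that[of "v $ 1" "v $ 2"])
      (simp_all add: v matrix_vector_mult_def sum_2 of_real_mat_def mat_def of_real_vec_def complex_eq_iff)
qed

lemma norm_sq_vec2: "(norm (z :: complex ^ 2))\<^sup>2 = (norm (z $ 1))\<^sup>2 + (norm (z $ 2))\<^sup>2"
  by (simp add: norm_vec_def L2_set_def sum_2)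

lemma quad_form_real_plane:
  assumes pos: "\<alpha> > 0" "\<alpha> * \<gamma> - \<beta>\<^sup>2 > 0" and z: "z \<in> real_plane"
  shows "Im (quad_form \<alpha> \<beta> \<gamma> z) = 0" "0 \<le> Re (quad_form \<alpha> \<beta> \<gamma> z)"
    "(norm z)\<^sup>2 \<le> (\<alpha> + \<gamma>) / (\<alpha> * \<gamma> - \<beta>\<^sup>2) * norm (quad_form \<alpha> \<beta> \<gamma> z)"
proof -
  define x y where "x = Re (z $ 1)" and "y = Re (z $ 2)"
  define Q where "Q = \<alpha> * x\<^sup>2 + 2 * \<beta> * (x * y) + \<gamma> * y\<^sup>2"
  have "z $ 1 = of_real x" "z $ 2 = of_real y" using z by (auto simp: x_def y_def real_plane_iff complex_eq_iff)
  then have eq: "quad_form \<alpha> \<beta> \<gamma> z = of_real Q" "(norm z)\<^sup>2 = x\<^sup>2 + y\<^sup>2"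
    by (simp_all add: quad_form_def Q_def norm_sq_vec2)
  have lb: "\<gamma> > 0" "(\<alpha> * \<gamma> - \<beta>\<^sup>2) * (x\<^sup>2 + y\<^sup>2) \<le> (\<alpha> + \<gamma>) * Q"
    unfolding Q_def by (rule positive_definite_lower_bound[OF pos])+
  have "0 \<le> (\<alpha> * \<gamma> - \<beta>\<^sup>2) * (x\<^sup>2 + y\<^sup>2)" using pos(2) by simp
  then have "0 \<le> (\<alpha> + \<gamma>) * Q" using lb(2) by linarith
  then have Q: "Q \<ge> 0" using pos(1) lb(1) by (simp add: zero_le_mult_iff)
  then show "Im (quad_form \<alpha> \<beta> \<gamma> z) = 0" "0 \<le> Re (quad_form \<alpha> \<beta> \<gamma> z)" by (simp_all add: eq)
  show "(norm z)\<^sup>2 \<le> (\<alpha> + \<gamma>) / (\<alpha> * \<gamma> - \<beta>\<^sup>2) * norm (quad_form \<alpha> \<beta> \<gamma> z)"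
    using lb(2) Q pos(2) by (simp add: eq le_divide_eq mult.commute)
qed

text \<open>The hypothesis \<open>sym\<close> says that \<open>A\<close> is self-adjoint for the form \<open>G\<close> with coefficients \<open>\<alpha>\<close>, \<open>\<beta>\<close>,
  \<open>\<gamma>\<close>. Then at \<open>(A + \<i> I) x\<close> the form has the value \<open>G((A + \<i> I)\<^sup>2 x, x)\<close>. Its imaginary part is
  \<open>2 G(A x, x)\<close>, and since \<open>A\<^sup>2 = tr A * A - det A * I\<close> its real part is
  \<open>tr A * G(A x, x) - (1 + det A) * G(x, x)\<close>. For \<open>x \<noteq> 0\<close> the term subtracted is positive, so that the values stay
  outside a sector around the positive axis whose opening depends on \<open>tr A\<close> only.\<close>

lemma quad_form_shifted_plane:
  assumes pos: "\<alpha> > 0" "\<alpha> * \<gamma> - \<beta>\<^sup>2 > 0"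
    and sym: "\<alpha> * A $ 1 $ 2 + \<beta> * A $ 2 $ 2 = \<beta> * A $ 1 $ 1 + \<gamma> * A $ 2 $ 1"
    and det: "det A > - 1"
  obtains c C where "c > 0"
    "\<And>z. z \<in> shifted_plane A \<Longrightarrow> Re (quad_form \<alpha> \<beta> \<gamma> z) \<le> c * \<bar>Im (quad_form \<alpha> \<beta> \<gamma> z)\<bar>"
    "\<And>z. z \<in> shifted_plane A \<Longrightarrow> (norm z)\<^sup>2 \<le> C * norm (quad_form \<alpha> \<beta> \<gamma> z)"
proof -
  define a b d e where "a = A $ 1 $ 1" and "b = A $ 1 $ 2" and "d = A $ 2 $ 1" and "e = A $ 2 $ 2"
  define D where "D = det A"
  have D: "D = a * e - b * d" by (simp add: D_def det_2 a_def b_def d_def e_def)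
  have D1: "1 + D > 0" using det by (simp add: D_def)
  have sym': "\<alpha> * b + \<beta> * e = \<beta> * a + \<gamma> * d" using sym by (simp add: a_def b_def d_def e_def)
  define m where "m = \<alpha> * \<gamma> - \<beta>\<^sup>2"
  have m: "m > 0" using pos by (simp add: m_def)
  define t where "t = a + e"
  define c where "c = \<bar>t\<bar> / 2 + 1"
  define k where "k = a\<^sup>2 + b\<^sup>2 + d\<^sup>2 + e\<^sup>2 + 2"
  define C where "C = k * ((\<alpha> + \<gamma>) / m) * (c / (1 + D))"
  have k: "k \<ge> 0" by (simp add: k_def)
  have main: "Re (quad_form \<alpha> \<beta> \<gamma> z) \<le> c * \<bar>Im (quad_form \<alpha> \<beta> \<gamma> z)\<bar> \<and>
      (norm z)\<^sup>2 \<le> C * norm (quad_form \<alpha> \<beta> \<gamma> z)"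
    if z: "z \<in> shifted_plane A" for z
  proof -
    obtain x y where xy: "z $ 1 = Complex (a * x + b * y) x" "z $ 2 = Complex (d * x + e * y) y"
      using shifted_planeE[OF z] unfolding a_def b_def d_def e_def by blast
    define Q where "Q = \<alpha> * x\<^sup>2 + 2 * \<beta> * (x * y) + \<gamma> * y\<^sup>2"
    define N where "N = \<alpha> * x * (a * x + b * y) + \<beta> * (x * (d * x + e * y) + y * (a * x + b * y)) + \<gamma> * y * (d * x + e * y)"
    let ?w = "quad_form \<alpha> \<beta> \<gamma> z"
    have Im: "Im ?w = 2 * N"
      by (simp add: quad_form_def xy N_def power2_eq_square algebra_simps)
    have "Re ?w = \<alpha> * ((a * x + b * y)\<^sup>2 - x\<^sup>2) + 2 * \<beta> * ((a * x + b * y) * (d * x + e * y) - x * y)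
        + \<gamma> * ((d * x + e * y)\<^sup>2 - y\<^sup>2)"
      by (simp add: quad_form_def xy power2_eq_square algebra_simps)
    also have "\<dots> = t * N - (1 + D) * Q"
      using sym' unfolding t_def N_def D Q_def by algebra
    finally have Re: "Re ?w = t / 2 * Im ?w - (1 + D) * Q" by (simp add: Im)
    have lb: "\<gamma> > 0" "m * (x\<^sup>2 + y\<^sup>2) \<le> (\<alpha> + \<gamma>) * Q"
      unfolding Q_def m_def by (rule positive_definite_lower_bound[OF pos])+
    have "0 \<le> m * (x\<^sup>2 + y\<^sup>2)" using m by simp
    then have "0 \<le> (\<alpha> + \<gamma>) * Q" using lb(2) by linarith
    then have Q: "Q \<ge> 0" using pos(1) lb(1) by (simp add: zero_le_mult_iff)
    have tI: "\<bar>t / 2 * Im ?w\<bar> = \<bar>t\<bar> / 2 * \<bar>Im ?w\<bar>" by (simp add: abs_mult)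
    have "Re ?w \<le> t / 2 * Im ?w" using Re Q D1 by simp
    also have "\<dots> \<le> \<bar>t\<bar> / 2 * \<bar>Im ?w\<bar>" using tI by linarith
    also have "\<dots> \<le> c * \<bar>Im ?w\<bar>" unfolding c_def by (intro mult_right_mono) auto
    finally have 1: "Re ?w \<le> c * \<bar>Im ?w\<bar>" .
    have "(1 + D) * Q \<le> \<bar>t\<bar> / 2 * \<bar>Im ?w\<bar> + \<bar>Re ?w\<bar>" using Re tI by linarith
    also have "\<dots> \<le> \<bar>t\<bar> / 2 * norm ?w + norm ?w"
      by (intro add_mono mult_left_mono abs_Im_le_cmod abs_Re_le_cmod) auto
    also have "\<dots> = c * norm ?w" by (simp add: c_def algebra_simps)
    finally have Qw: "Q \<le> c / (1 + D) * norm ?w" using D1 by (simp add: field_simps)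
    have cs: "(u * x + v * y)\<^sup>2 \<le> (u\<^sup>2 + v\<^sup>2) * (x\<^sup>2 + y\<^sup>2)" for u v
    proof -
      have "0 \<le> (u * y - v * x)\<^sup>2" by simp
      then show ?thesis by (simp add: power2_eq_square algebra_simps)
    qed
    have "(norm z)\<^sup>2 = (a * x + b * y)\<^sup>2 + x\<^sup>2 + ((d * x + e * y)\<^sup>2 + y\<^sup>2)"
      by (simp add: norm_sq_vec2 xy cmod_power2)
    also have "\<dots> \<le> (a\<^sup>2 + b\<^sup>2) * (x\<^sup>2 + y\<^sup>2) + (x\<^sup>2 + y\<^sup>2) + ((d\<^sup>2 + e\<^sup>2) * (x\<^sup>2 + y\<^sup>2) + (x\<^sup>2 + y\<^sup>2))"
      by (intro add_mono cs) auto
    also have "\<dots> = k * (x\<^sup>2 + y\<^sup>2)" by (simp add: k_def algebra_simps)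
    also have "\<dots> \<le> k * ((\<alpha> + \<gamma>) / m * Q)"
      using lb(2) m k by (intro mult_left_mono) (auto simp: le_divide_eq mult.commute)
    also have "\<dots> \<le> k * ((\<alpha> + \<gamma>) / m * (c / (1 + D) * norm ?w))"
      using Qw k pos(1) lb(1) m by (intro mult_left_mono) auto
    finally show ?thesis using 1 by (simp add: C_def mult_ac)
  qed
  show thesis
  proof (rule that)
    show "c > 0" by (simp add: c_def add_nonneg_pos)
  qed (use main in blast)+
qed

text \<open>Let \<open>C\<close> be the commutator and \<open>J\<close> the matrix with rows \<open>(0, 1)\<close> and \<open>(-1, 0)\<close>. A product \<open>J X\<close> is
  symmetric exactly if \<open>X\<close> has trace zero. As \<open>C\<close>, \<open>C A\<close> and \<open>C B\<close> have trace zero, \<open>G = J C\<close> is a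
  symmetric form for which \<open>A\<close> and \<open>B\<close> are self-adjoint, and \<open>det G = det C > 0\<close> makes it definite.
  The sign of \<open>C $ 2 $ 1\<close> decides whether \<open>G\<close> or \<open>- G\<close> is positive.\<close>

lemma commutator_symmetrizing_form:
  assumes "det (commutator A B) > 0"
  obtains \<alpha> \<beta> \<gamma> where "\<alpha> > 0" "\<alpha> * \<gamma> - \<beta>\<^sup>2 > 0"
    "\<alpha> * A $ 1 $ 2 + \<beta> * A $ 2 $ 2 = \<beta> * A $ 1 $ 1 + \<gamma> * A $ 2 $ 1"
    "\<alpha> * B $ 1 $ 2 + \<beta> * B $ 2 $ 2 = \<beta> * B $ 1 $ 1 + \<gamma> * B $ 2 $ 1"
proof -
  define C where "C = commutator A B"
  have C: "C $ i $ j = (\<Sum>k\<in>UNIV. A $ i $ k * B $ k $ j) - (\<Sum>k\<in>UNIV. B $ i $ k * A $ k $ j)" for i j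
    by (simp add: C_def commutator_def matrix_matrix_mult_def)
  have tr: "C $ 2 $ 2 = - C $ 1 $ 1" by (simp add: C sum_2)
  have det: "- (C $ 1 $ 1)\<^sup>2 - C $ 1 $ 2 * C $ 2 $ 1 > 0"
    using assms unfolding C_def[symmetric] det_2 tr by (simp add: power2_eq_square)
  then have "C $ 2 $ 1 \<noteq> 0" using zero_le_power2[of "C $ 1 $ 1"] by (intro notI) simp
  define s where "s = sgn (C $ 2 $ 1)"
  have s: "s * C $ 2 $ 1 > 0" "s\<^sup>2 = 1"
    using \<open>C $ 2 $ 1 \<noteq> 0\<close> by (auto simp: s_def sgn_if)
  have sym: "C $ 2 $ 1 * A $ 1 $ 2 - C $ 1 $ 1 * A $ 2 $ 2 = - C $ 1 $ 1 * A $ 1 $ 1 - C $ 1 $ 2 * A $ 2 $ 1"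
    "C $ 2 $ 1 * B $ 1 $ 2 - C $ 1 $ 1 * B $ 2 $ 2 = - C $ 1 $ 1 * B $ 1 $ 1 - C $ 1 $ 2 * B $ 2 $ 1"
    by (simp_all add: C sum_2 algebra_simps)
  show thesis
  proof (rule that)
    show "s * C $ 2 $ 1 > 0" by (rule s)
    have "s * C $ 2 $ 1 * (- s * C $ 1 $ 2) - (- s * C $ 1 $ 1)\<^sup>2 = s\<^sup>2 * (- (C $ 1 $ 1)\<^sup>2 - C $ 1 $ 2 * C $ 2 $ 1)"
      by (simp add: power2_eq_square algebra_simps)
    then show "s * C $ 2 $ 1 * (- s * C $ 1 $ 2) - (- s * C $ 1 $ 1)\<^sup>2 > 0" using det s(2) by simp
    show "s * C $ 2 $ 1 * A $ 1 $ 2 + - s * C $ 1 $ 1 * A $ 2 $ 2 = - s * C $ 1 $ 1 * A $ 1 $ 1 + - s * C $ 1 $ 2 * A $ 2 $ 1"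
      using arg_cong[OF sym(1), of "(*) s"] by (simp add: algebra_simps)
    show "s * C $ 2 $ 1 * B $ 1 $ 2 + - s * C $ 1 $ 1 * B $ 2 $ 2 = - s * C $ 1 $ 1 * B $ 1 $ 1 + - s * C $ 1 $ 2 * B $ 2 $ 1"
      using arg_cong[OF sym(2), of "(*) s"] by (simp add: algebra_simps)
  qed
qed

section \<open>Unions of three totally real planes\<close>

theorem locally_polynomially_convex_three_planes:
  fixes A B :: "real ^ 2 ^ 2"
  assumes comm: "det (commutator A B) > 0" and dets: "det A > - 1" "det B > - 1"
    and pair: "locally_polynomially_convex_at (shifted_plane A \<union> shifted_plane B) 0"
  shows "locally_polynomially_convex_at (real_plane \<union> shifted_plane A \<union> shifted_plane B) 0"
proof -
  let ?P = "shifted_plane A \<union> shifted_plane B"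
  obtain r where r: "r > 0" "polynomially_convex (?P \<inter> cball 0 r)" and P: "closed ?P" "0 \<in> ?P"
    using pair by (auto simp: locally_polynomially_convex_at_def)
  obtain \<alpha> \<beta> \<gamma> where pos: "\<alpha> > 0" "\<alpha> * \<gamma> - \<beta>\<^sup>2 > 0" and sym:
    "\<alpha> * A $ 1 $ 2 + \<beta> * A $ 2 $ 2 = \<beta> * A $ 1 $ 1 + \<gamma> * A $ 2 $ 1"
    "\<alpha> * B $ 1 $ 2 + \<beta> * B $ 2 $ 2 = \<beta> * B $ 1 $ 1 + \<gamma> * B $ 2 $ 1"
    using commutator_symmetrizing_form[OF comm] by blast
  let ?q = "quad_form \<alpha> \<beta> \<gamma>"
  obtain c1 C1 where A: "c1 > 0"
    "\<And>z. z \<in> shifted_plane A \<Longrightarrow> Re (?q z) \<le> c1 * \<bar>Im (?q z)\<bar>"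
    "\<And>z. z \<in> shifted_plane A \<Longrightarrow> (norm z)\<^sup>2 \<le> C1 * norm (?q z)"
    using quad_form_shifted_plane[OF pos sym(1) dets(1)] by blast
  obtain c2 C2 where B: "c2 > 0"
    "\<And>z. z \<in> shifted_plane B \<Longrightarrow> Re (?q z) \<le> c2 * \<bar>Im (?q z)\<bar>"
    "\<And>z. z \<in> shifted_plane B \<Longrightarrow> (norm z)\<^sup>2 \<le> C2 * norm (?q z)"
    using quad_form_shifted_plane[OF pos sym(2) dets(2)] by blast
  define c C0 C where "c = max c1 c2" and "C0 = (\<alpha> + \<gamma>) / (\<alpha> * \<gamma> - \<beta>\<^sup>2)" and "C = max C0 (max C1 C2)"
  have c: "c > 0" using A(1) by (simp add: c_def)
  have weaken: "u \<le> k * v \<Longrightarrow> k \<le> k' \<Longrightarrow> v \<ge> 0 \<Longrightarrow> u \<le> k' * v" for u v k k' :: real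
    by (meson mult_right_mono order_trans)
  have "polynomially_convex ((real_plane \<inter> cball 0 r) \<union> (?P \<inter> cball 0 r))"
  proof (rule polynomially_convex_Un_ray_sector[where P = ?q and c = c and C = C])
    show "polynomially_convex (real_plane \<inter> cball 0 r)" by (rule polynomially_convex_real_ball[OF r(1)])
    show "polynomially_convex (?P \<inter> cball 0 r)" by (rule r(2))
    show "0 \<in> real_plane \<inter> cball 0 r" "0 \<in> ?P \<inter> cball 0 r"
      using r(1) P by (auto simp: real_plane_iff)
    show "polynomial2 ?q" by (rule polynomial2_quad_form)
    show "c > 0" by (rule c)
    fix z
    show "Im (?q z) = 0 \<and> 0 \<le> Re (?q z)" if "z \<in> real_plane \<inter> cball 0 r"
      using quad_form_real_plane[OF pos] that by auto
    show "Re (?q z) \<le> c * \<bar>Im (?q z)\<bar>" if "z \<in> ?P \<inter> cball 0 r"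
      using that A(2)[of z] B(2)[of z] by (auto simp: c_def intro: weaken)
    show "(norm z)\<^sup>2 \<le> C * norm (?q z)" if "z \<in> real_plane \<inter> cball 0 r \<union> ?P \<inter> cball 0 r"
      using that A(3)[of z] B(3)[of z] quad_form_real_plane(3)[OF pos, of z, folded C0_def]
      by (auto simp: C_def intro: weaken)
  qed
  moreover have "(real_plane \<inter> cball 0 r) \<union> (?P \<inter> cball 0 r) = (real_plane \<union> shifted_plane A \<union> shifted_plane B) \<inter> cball 0 r"
    by auto
  moreover have "closed (real_plane \<union> shifted_plane A \<union> shifted_plane B)"
    using closed_Un[OF closed_real_plane P(1)] by (simp add: Un_assoc)
  ultimately show ?thesis
    using P(2) r(1) unfolding locally_polynomially_convex_at_def by auto
qed

theorem theorem3p2: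
  fixes A1 A2 :: "real ^ 2 ^ 2"
    and P0 P1 P2 :: "(complex ^ 2) set"
  defines "P0 \<equiv> real_plane"
    and "P1 \<equiv> shifted_plane A1"
    and "P2 \<equiv> shifted_plane A2"
  assumes "maximal_totally_real P0"
    and "maximal_totally_real P1"
    and "maximal_totally_real P2"
    and "locally_polynomially_convex_at (P0 \<union> P1) 0"
    and "locally_polynomially_convex_at (P0 \<union> P2) 0"
    and "locally_polynomially_convex_at (P1 \<union> P2) 0"
    and "det (commutator A1 A2) > 0"
    and "-1 < det A1" and "det A1 < 0"
    and "det A2 > 0"
  shows "locally_polynomially_convex_at (P0 \<union> P1 \<union> P2) 0"
proof -
  have "det A2 > - 1" using \<open>det A2 > 0\<close> by simp
  then show ?thesis
    using locally_polynomially_convex_three_planes[of A1 A2] assms by simp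
qed

end
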